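(* Let $\omega>0$, $0<\gamma<1$, $0<\rho<\frac16\omega^{-1}\gamma$, and let $\{x_k\}_{k\in\mathbb{Z}}$ be an increasing sequence of real numbers such that $\rho/2\le|x_k-x_{k+1}|\le\rho$ for all $k$. Then there exist strictly positive coefficients $\lambda_{x_k}>0$, which are of the order $\rho$, for which the following equality holds for all functions $f\in PW_{\omega}(\mathbb{R})\cap L_1(\mathbb{R})$: $$\int_{\mathbb{R}}f\,dx=\sum_{k}\lambda_{x_k}f(x_k).$$
   Context: $PW_{\omega}(\mathbb{R})$ is the space of all $f\in L_2(\mathbb{R})$ whose $L_2$-Fourier transform $\widehat f(\lambda)=\frac{1}{\sqrt{2\pi}}\int e^{-ix\lambda}f(x)\,dx$ has support in $[-\omega,\omega]$; point values refer to the continuous representative. "Of the order $\rho$" means $c_1\rho\le\lambda_{x_k}\le c_2\rho$ for all $k$ with positive constants $c_1,c_2$ independent of $k$ and $\rho$. *)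

theory Defs
  imports "HOL-Analysis.Analysis"
begin

definition square_integrable :: "(real \<Rightarrow> complex) \<Rightarrow> bool" where
  "square_integrable f \<longleftrightarrow>
     f \<in> borel_measurable lborel \<and> integrable lborel (\<lambda>x. (cmod (f x))\<^sup>2)"

definition fourier_truncated :: "(real \<Rightarrow> complex) \<Rightarrow> real \<Rightarrow> real \<Rightarrow> complex" where
  "fourier_truncated f R l =
     complex_of_real (1 / sqrt (2 * pi)) *
       set_lebesgue_integral lborel {- R..R} (\<lambda>x. exp (- \<i> * of_real (x * l)) * f x)"

text \<open>
  The \<open>L\<^sub>2\<close>-Fourier transform of a square-integrable function is the limit in \<open>L\<^sub>2\<close> of the
  truncated Fourier integrals. Being determined only up to null sets, it is stated as a relation:
  \<open>g\<close> is a representative of the transform of \<open>f\<close>. The extended nonnegative integral is used for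
  the squared \<open>L\<^sub>2\<close>-distance because it is meaningful without an integrability side condition.
\<close>

definition has_L2_fourier_transform :: "(real \<Rightarrow> complex) \<Rightarrow> (real \<Rightarrow> complex) \<Rightarrow> bool" where
  "has_L2_fourier_transform f g \<longleftrightarrow>
     square_integrable f \<and> square_integrable g \<and>
     ((\<lambda>R. \<integral>\<^sup>+ l. ennreal ((cmod (fourier_truncated f R l - g l))\<^sup>2) \<partial>lborel) \<longlongrightarrow> 0) at_top"

text \<open>
  Each element of \<open>PW\<^sub>\<omega>(\<real>)\<close> is an almost-everywhere class with exactly one continuous representative;
  the set below consists of these representatives, so that point values make sense. The (essential)
  support of the transform lies in the closed interval \<open>[-\<omega>, \<omega>]\<close> iff it vanishes almost everywhere
  outside that interval.
\<close>

definition paley_wiener :: "real \<Rightarrow> (real \<Rightarrow> complex) set" where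
  "paley_wiener \<omega> = {f. continuous_on UNIV f \<and> square_integrable f \<and>
     (\<exists>g. has_L2_fourier_transform f g \<and> (AE l in lborel. l \<notin> {- \<omega>..\<omega>} \<longrightarrow> g l = 0))}"

end

theory Submission
  imports Defs "HOL-Probability.Characteristic_Functions"
begin

text \<open>
  The weights are a small perturbation of the gaps. Put \<open>w\<^sub>k = x\<^sub>k\<^sub>+\<^sub>1 - x\<^sub>k\<close> and replace a function \<open>g\<close> by
  the step function with value \<open>g(x\<^sub>k)\<close> on the cell \<open>[x\<^sub>k, x\<^sub>k\<^sub>+\<^sub>1)\<close>. Its \<open>L\<^sub>1\<close>-distance from \<open>g\<close> is at
  most \<open>\<rho> \<parallel>g'\<parallel>\<^sub>1\<close>, and Bernstein's inequality \<open>\<parallel>g'\<parallel>\<^sub>1 \<le> 2 \<omega> \<parallel>g\<parallel>\<^sub>1\<close> turns this into at most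
  \<open>\<parallel>g\<parallel>\<^sub>1 / 3\<close>, because \<open>2 \<rho> \<omega> < \<gamma> / 3\<close>. Two consequences follow. The step function still has at least
  two thirds of the \<open>L\<^sub>1\<close>-norm of \<open>g\<close>, so \<open>\<parallel>g\<parallel>\<^sub>1 \<le> 3/2 \<Sum>\<^sub>k w\<^sub>k |g(x\<^sub>k)|\<close>; and the
  error \<open>\<integral>g - \<Sum>\<^sub>k w\<^sub>k g(x\<^sub>k)\<close> is at most \<open>\<parallel>g\<parallel>\<^sub>1 / 3\<close> in absolute value. Hence the error is a linear
  functional of the weighted sample sequence, with norm at most \<open>1/2\<close> on a subspace of \<open>\<ell>\<^sub>1\<close>. A norm-preserving
  extension to \<open>\<ell>\<^sub>1\<close> is given by a sequence \<open>e\<close> with \<open>|e\<^sub>k| \<le> 1/2\<close>, and the weights \<open>w\<^sub>k (1 + e\<^sub>k)\<close> are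
  exact on the whole space and lie between \<open>\<rho>/4\<close> and \<open>3\<rho>/2\<close>.

  This argument is \<open>positive_quadrature_from_Bernstein\<close>; the extension step is \<open>l1_functional_extension\<close>.
  The remaining work is Bernstein's inequality in \<open>L\<^sub>1\<close>. The Fourier multiplier of differentiation
  is \<open>\<i> l\<close>, that of the central difference with step \<open>1/\<omega>\<close> is \<open>\<i> sin(l/\<omega>)\<close>, and for \<open>|l| \<le> \<omega>\<close> the
  arcsine series expresses the first as an absolutely summable power series in the second. The
  derivative is therefore a series of iterated central differences, none of which increases the \<open>L\<^sub>1\<close>-norm
  (\<open>Bernstein_inequality_L1\<close>).

  Finally, a function in \<open>PW\<^sub>\<omega> \<inter> L\<^sub>1\<close> must be written as a Fourier integral over \<open>[-\<omega>, \<omega>]\<close>. Its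
  \<open>L\<^sub>1\<close>- and \<open>L\<^sub>2\<close>-transforms agree almost everywhere by Fatou's lemma, so the \<open>L\<^sub>1\<close>-transform is
  bounded with bounded support, and Fourier inversion in \<open>L\<^sub>1\<close>, by Gaussian summation, applies.
\<close>

section \<open>Bounded functionals on subspaces of the sequence space\<close>

text \<open>
  The inductive step of a Hahn--Banach extension on \<open>\<ell>\<^sub>1\<close>. The set \<open>U\<close> is the graph of a linear functional
  on a space of sequences, of which the part carried by the first \<open>n\<close> coordinates has been split off. Normalised to
  \<open>s n = 1\<close>, each pair of the graph confines the next coefficient \<open>y\<close> to an interval. Any two of these intervals meet,
  since the difference of two normalised sequences has \<open>n\<close>-th entry zero, and each of them meets
  \<open>[-c, c]\<close>; on the real line they then have a common point.
\<close>
lemma extend_functional_by_one_coordinate: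
  fixes U :: "((nat \<Rightarrow> real) \<times> real) set"
  assumes lin: "\<And>s r s' r' a. (s, r) \<in> U \<Longrightarrow> (s', r') \<in> U \<Longrightarrow> (\<lambda>k. a * s k + s' k, a * r + r') \<in> U"
    and summ: "\<And>s r. (s, r) \<in> U \<Longrightarrow> summable (\<lambda>k. \<bar>s k\<bar>)"
    and bd: "\<And>s r. (s, r) \<in> U \<Longrightarrow> \<bar>r - (\<Sum>k<n. e k * s k)\<bar> \<le> c * (\<Sum>k. \<bar>s (k + n)\<bar>)"
    and c: "0 \<le> c"
  shows "\<exists>y. \<bar>y\<bar> \<le> c \<and> (\<forall>(s, r)\<in>U.
           \<bar>r - (\<Sum>k<n. e k * s k) - y * s n\<bar> \<le> c * (\<Sum>k. \<bar>s (k + Suc n)\<bar>))"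
proof -
  define R where "R s r = r - (\<Sum>k<n. e k * s k)" for s :: "nat \<Rightarrow> real" and r :: real
  define T where "T s = c * (\<Sum>k. \<bar>s (k + Suc n)\<bar>)" for s :: "nat \<Rightarrow> real"
  \<comment> \<open>The lower ends of the intervals; \<open>-c\<close> is the lower end of the constraint \<open>|y| \<le> c\<close>.\<close>
  define L where "L = insert (- c) {R s r - T s | s r. (s, r) \<in> U \<and> s n = 1}"
  have R_lin: "R (\<lambda>k. a * s k + s' k) (a * r + r') = a * R s r + R s' r'" for a s r s' r'
    unfolding R_def by (simp add: algebra_simps sum.distrib sum_distrib_left)
  have tail: "summable (\<lambda>k. \<bar>s (k + m)\<bar>)" if "(s, r) \<in> U" for s r m
    using summ[OF that] by (simp add: summable_iff_shift[of "\<lambda>k. \<bar>s k\<bar>"])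
  have R_bd: "\<bar>R s r\<bar> \<le> c * \<bar>s n\<bar> + T s" if "(s, r) \<in> U" for s r
  proof -
    have "(\<Sum>k. \<bar>s (k + n)\<bar>) = \<bar>s n\<bar> + (\<Sum>k. \<bar>s (k + Suc n)\<bar>)"
      using suminf_split_head[OF tail[OF that, of n]] by simp
    then show ?thesis
      using bd[OF that] unfolding R_def T_def by (simp add: algebra_simps)
  qed
  have T_diff: "T (\<lambda>k. - 1 * s k + s' k) \<le> T s + T s'" if "(s, r) \<in> U" "(s', r') \<in> U" for s r s' r'
  proof -
    have "(\<Sum>k. \<bar>- 1 * s (k + Suc n) + s' (k + Suc n)\<bar>) \<le> (\<Sum>k. \<bar>s (k + Suc n)\<bar> + \<bar>s' (k + Suc n)\<bar>)"
      using tail[OF lin[OF that, of "-1"], of "Suc n"]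
      by (intro suminf_le summable_add tail[OF that(1)] tail[OF that(2)]) auto
    also have "\<dots> = (\<Sum>k. \<bar>s (k + Suc n)\<bar>) + (\<Sum>k. \<bar>s' (k + Suc n)\<bar>)"
      by (intro suminf_add[symmetric] tail[OF that(1)] tail[OF that(2)])
    finally show ?thesis
      using mult_left_mono[OF _ c] unfolding T_def by (simp add: distrib_left [symmetric])
  qed
  have le_upper: "z \<le> R s r + T s" if "z \<in> L" "(s, r) \<in> U" "s n = 1" for z s r
    using that(1) unfolding L_def
  proof (elim insertE)
    assume "z = - c"
    then show ?thesis using R_bd[OF that(2)] that(3) by auto
  next
    assume "z \<in> {R s r - T s | s r. (s, r) \<in> U \<and> s n = 1}"
    then obtain s' r' where *: "z = R s' r' - T s'" "(s', r') \<in> U" "s' n = 1" by auto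
    have "\<bar>R (\<lambda>k. - 1 * s k + s' k) (- 1 * r + r')\<bar> \<le> T s + T s'"
      using R_bd[OF lin[OF that(2) *(2), of "-1"]] T_diff[OF that(2) *(2)] that(3) *(3) by simp
    then show ?thesis unfolding R_lin using * by simp
  qed
  have le_c: "z \<le> c" if "z \<in> L" for z
    using that unfolding L_def
  proof (elim insertE)
    assume "z \<in> {R s r - T s | s r. (s, r) \<in> U \<and> s n = 1}"
    then obtain s r where "z = R s r - T s" "(s, r) \<in> U" "s n = 1" by auto
    then show ?thesis using R_bd[of s r] by simp
  qed (use c in simp)
  have bdd: "bdd_above L" using le_c by (rule bdd_aboveI)
  define y where "y = Sup L"
  have y_ge: "z \<le> y" if "z \<in> L" for z unfolding y_def using that bdd by (rule cSup_upper)
  have y_le: "y \<le> z" if "\<And>w. w \<in> L \<Longrightarrow> w \<le> z" for z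
    unfolding y_def by (rule cSup_least) (use that in \<open>auto simp: L_def\<close>)
  have "\<bar>y\<bar> \<le> c" using y_ge[of "- c"] y_le[of c] le_c by (auto simp: L_def)
  moreover have "\<bar>R s r - y * s n\<bar> \<le> T s" if sr: "(s, r) \<in> U" for s r
  proof (cases "s n = 0")
    case True
    then show ?thesis using R_bd[OF sr] by simp
  next
    case False
    have zero: "(\<lambda>_. 0, 0) \<in> U" using lin[OF sr sr, of "-1"] by simp
    define s1 where "s1 = (\<lambda>k. inverse (s n) * s k)"
    have mem: "(s1, inverse (s n) * r) \<in> U"
      using lin[OF sr zero, of "inverse (s n)"] unfolding s1_def by simp
    have s1n: "s1 n = 1" using False by (simp add: s1_def)
    have R1: "R s1 (inverse (s n) * r) = inverse (s n) * R s r"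
      using R_lin[of "inverse (s n)" s "\<lambda>_. 0" r 0] by (simp add: s1_def R_def)
    have T1: "T s1 = \<bar>inverse (s n)\<bar> * T s"
      unfolding T_def s1_def abs_mult
      using suminf_mult[OF tail[OF sr, of "Suc n"], of "\<bar>inverse (s n)\<bar>"] by simp
    have "\<bar>R s1 (inverse (s n) * r) - y\<bar> \<le> T s1"
    proof -
      have "R s1 (inverse (s n) * r) - T s1 \<in> L"
        unfolding L_def using mem s1n by blast
      from y_ge[OF this] y_le[OF le_upper[OF _ mem s1n]] show ?thesis by linarith
    qed
    then have "\<bar>s n\<bar> * \<bar>inverse (s n) * R s r - y\<bar> \<le> \<bar>s n\<bar> * (\<bar>inverse (s n)\<bar> * T s)"
      unfolding R1 T1 by (intro mult_left_mono) auto
    moreover have "\<bar>s n\<bar> * \<bar>inverse (s n) * R s r - y\<bar> = \<bar>R s r - y * s n\<bar>"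
      unfolding abs_mult[symmetric] using False
      by (simp add: right_diff_distrib mult.commute[of y] flip: mult.assoc)
    moreover have "\<bar>s n\<bar> * (\<bar>inverse (s n)\<bar> * T s) = T s"
      unfolding mult.assoc[symmetric] abs_mult[symmetric] using False by simp
    ultimately show ?thesis by linarith
  qed
  ultimately have "\<bar>y\<bar> \<le> c \<and> (\<forall>(s, r)\<in>U. \<bar>R s r - y * s n\<bar> \<le> T s)"
    by blast
  then show ?thesis unfolding R_def T_def by (rule exI)
qed

text \<open>
  The dual of \<open>\<ell>\<^sub>1\<close> is \<open>\<ell>\<^sub>\<infinity>\<close>, so a functional of norm at most \<open>c\<close> on a subspace is given by
  a sequence bounded by \<open>c\<close>. Choosing one coefficient at a time keeps the remaining functional bounded by
  \<open>c\<close> times the tail of the \<open>\<ell>\<^sub>1\<close>-norm; this tail tends to zero, so the choice principle for sequences replaces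
  Zorn's lemma.
\<close>
lemma l1_functional_extension:
  fixes U :: "((nat \<Rightarrow> real) \<times> real) set"
  assumes lin: "\<And>s r s' r' a. (s, r) \<in> U \<Longrightarrow> (s', r') \<in> U \<Longrightarrow> (\<lambda>k. a * s k + s' k, a * r + r') \<in> U"
    and summ: "\<And>s r. (s, r) \<in> U \<Longrightarrow> summable (\<lambda>k. \<bar>s k\<bar>)"
    and bd: "\<And>s r. (s, r) \<in> U \<Longrightarrow> \<bar>r\<bar> \<le> c * (\<Sum>k. \<bar>s k\<bar>)"
    and c: "0 \<le> c"
  obtains e where "\<And>k. \<bar>e k\<bar> \<le> c" and "\<And>s r. (s, r) \<in> U \<Longrightarrow> (\<lambda>k. e k * s k) sums r"
proof -
  define P where "P n e \<longleftrightarrow> (\<forall>k<n. \<bar>e k\<bar> \<le> c) \<and>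
    (\<forall>(s, r)\<in>U. \<bar>r - (\<Sum>k<n. e k * s k)\<bar> \<le> c * (\<Sum>k. \<bar>s (k + n)\<bar>))" for n and e :: "nat \<Rightarrow> real"
  have "\<exists>E. \<forall>n. P n (E n) \<and> (\<forall>k<n. E (Suc n) k = E n k)"
  proof (rule dependent_nat_choice)
    show "\<exists>e. P 0 e" using bd by (auto simp: P_def)
  next
    fix e n assume P: "P n e"
    have "\<exists>y. \<bar>y\<bar> \<le> c \<and> (\<forall>(s, r)\<in>U.
        \<bar>r - (\<Sum>k<n. e k * s k) - y * s n\<bar> \<le> c * (\<Sum>k. \<bar>s (k + Suc n)\<bar>))"
    proof (rule extend_functional_by_one_coordinate[where U = U and n = n and e = e and c = c])
      show "(\<lambda>k. a * s k + s' k, a * r + r') \<in> U" if "(s, r) \<in> U" "(s', r') \<in> U" for s r s' r' a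
        using that by (rule lin)
      show "summable (\<lambda>k. \<bar>s k\<bar>)" if "(s, r) \<in> U" for s r
        using that by (rule summ)
      show "0 \<le> c" by (rule c)
      show "\<bar>r - (\<Sum>k<n. e k * s k)\<bar> \<le> c * (\<Sum>k. \<bar>s (k + n)\<bar>)" if "(s, r) \<in> U" for s r
        using P that by (auto simp: P_def)
    qed
    then obtain y where y: "\<bar>y\<bar> \<le> c" "\<forall>(s, r)\<in>U.
        \<bar>r - (\<Sum>k<n. e k * s k) - y * s n\<bar> \<le> c * (\<Sum>k. \<bar>s (k + Suc n)\<bar>)"
      by blast
    have "(\<Sum>k<n. (e(n := y)) k * s k) = (\<Sum>k<n. e k * s k)" for s
      by (intro sum.cong) auto
    then have "P (Suc n) (e(n := y))"
      using P y unfolding P_def by (auto simp: less_Suc_eq diff_diff_eq)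
    then show "\<exists>e'. P (Suc n) e' \<and> (\<forall>k<n. e' k = e k)"
      by (intro exI[of _ "e(n := y)"]) auto
  qed
  then obtain E where E: "\<And>n. P n (E n)" "\<And>n k. k < n \<Longrightarrow> E (Suc n) k = E n k" by blast
  define e where "e k = E (Suc k) k" for k
  have E_eq: "E n k = e k" if "k < n" for n k
    using that
  proof (induction n)
    case (Suc n)
    then show ?case using E(2)[of k n] by (cases "k = n") (auto simp: e_def)
  qed simp
  show thesis
  proof (rule that)
    show "\<bar>e k\<bar> \<le> c" for k using E(1)[of "Suc k"] by (auto simp: P_def e_def)
    fix s r assume sr: "(s, r) \<in> U"
    have bd': "\<bar>(\<Sum>k<n. e k * s k) - r\<bar> \<le> c * (\<Sum>k. \<bar>s (k + n)\<bar>)" for n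
    proof -
      have "(\<Sum>k<n. e k * s k) = (\<Sum>k<n. E n k * s k)" by (intro sum.cong) (auto simp: E_eq)
      then show ?thesis using E(1)[of n] sr by (auto simp: P_def abs_minus_commute)
    qed
    have lim: "(\<lambda>n. c * (\<Sum>k. \<bar>s (k + n)\<bar>)) \<longlonglongrightarrow> 0"
      using tendsto_mult_left[OF suminf_exist_split2[OF summ[OF sr]], of c] by simp
    have "(\<lambda>n. (\<Sum>k<n. e k * s k) - r) \<longlonglongrightarrow> 0"
      by (rule Lim_null_comparison[OF always_eventually lim]) (simp add: bd')
    then show "(\<lambda>k. e k * s k) sums r"
      unfolding sums_def by (simp add: LIM_zero_iff)
  qed
qed

section \<open>Positive quadrature from a Bernstein inequality\<close>

lemma cells_disjoint:
  fixes x :: "int \<Rightarrow> real"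
  assumes "strict_mono x" and "i \<noteq> j"
  shows "{x i..<x (i + 1)} \<inter> {x j..<x (j + 1)} = {}"
proof -
  have "x (k + 1) \<le> x l" if "k < l" for k l
    using strict_mono_less_eq[OF assms(1), of "k + 1" l] that by simp
  then show ?thesis using assms(2) by (cases i j rule: linorder_cases) force+
qed

text \<open>
  Gaps bounded below force \<open>x\<close> to be unbounded in both directions; a point outside every cell
  would then bound \<open>x\<close> from above, by induction along the cells.
\<close>
lemma cells_cover:
  fixes x :: "int \<Rightarrow> real"
  assumes "0 < \<delta>" and gap: "\<And>k. \<delta> \<le> x (k + 1) - x k"
  shows "(\<Union>k. {x k..<x (k + 1)}) = UNIV"
proof -
  have "t \<in> (\<Union>k. {x k..<x (k + 1)})" for t
  proof -
  have up: "x 0 + real n * \<delta> \<le> x (int n)" for n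
  proof (induction n)
    case (Suc n)
    then show ?case using gap[of "int n"] by (simp add: algebra_simps)
  qed simp
  have down: "x (- int n) \<le> x 0 - real n * \<delta>" for n
  proof (induction n)
    case (Suc n)
    then show ?case using gap[of "- int (Suc n)"] by (simp add: algebra_simps)
  qed simp
  obtain n where n: "\<bar>t - x 0\<bar> < real n * \<delta>"
    using reals_Archimedean3[OF \<open>0 < \<delta>\<close>] by blast
  have lo: "x (- int n) \<le> t" and hi: "t < x (int n)"
    using up[of n] down[of n] n by auto
  have "\<exists>k. x k \<le> t \<and> t < x (k + 1)"
  proof (rule ccontr)
    assume "\<not> ?thesis"
    then have step: "x (k + 1) \<le> t" if "x k \<le> t" for k using that by force
    have "x k \<le> t" if "- int n \<le> k" for k
      using that by (induction k rule: int_ge_induct) (auto intro: lo step)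
    from this[of "int n"] hi show False by simp
  qed
  then show ?thesis by auto
  qed
  then show ?thesis by blast
qed

lemma set_integral_sums:
  fixes f :: "'a \<Rightarrow> real" and A :: "nat \<Rightarrow> 'a set"
  assumes f: "integrable M f" and A: "\<And>n. A n \<in> sets M"
    and disj: "disjoint_family A" and cover: "(\<Union>n. A n) = UNIV"
  shows "(\<lambda>n. LINT t:A n|M. f t) sums (\<integral>t. f t \<partial>M)"
proof -
  have int: "integrable M (\<lambda>t. indicator (A n) t *\<^sub>R f t)" for n
    by (rule integrable_mult_indicator[OF A f])
  have ind: "(\<Sum>n<m. indicator (A n) t) = (indicator (\<Union>n<m. A n) t :: real)" for m t
    by (rule indicator_UN_disjoint[symmetric]) (use disj in \<open>auto simp: disjoint_family_on_def\<close>)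
  have pointwise: "(\<lambda>n. indicator (A n) t *\<^sub>R f t) sums f t" for t
  proof -
    obtain n where n: "t \<in> A n" using cover by auto
    have "t \<notin> A m" if "m \<noteq> n" for m using disj n that by (auto simp: disjoint_family_on_def)
    then have "(\<lambda>m. indicator (A m) t *\<^sub>R f t) = (\<lambda>m. if m = n then f t else 0)"
      using n by (auto simp: indicator_def)
    then show ?thesis using sums_single[of n "\<lambda>_. f t"] by simp
  qed
  have pointwise_norm: "summable (\<lambda>n. norm (indicator (A n) t *\<^sub>R f t))" for t
    by (rule bounded_imp_summable[where B = "\<bar>f t\<bar>"])
      (auto simp: ind abs_mult sum_distrib_right[symmetric] lessThan_Suc_atMost[symmetric]
        intro!: mult_left_le_one_le split: split_indicator)
  have "summable (\<lambda>n. \<integral>t. norm (indicator (A n) t *\<^sub>R f t) \<partial>M)"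
  proof (rule summableI_nonneg_bounded)
    show "(\<Sum>n<m. \<integral>t. norm (indicator (A n) t *\<^sub>R f t) \<partial>M) \<le> (\<integral>t. \<bar>f t\<bar> \<partial>M)" for m
    proof -
      have "(\<Sum>n<m. \<integral>t. norm (indicator (A n) t *\<^sub>R f t) \<partial>M)
          = (\<integral>t. (\<Sum>n<m. norm (indicator (A n) t *\<^sub>R f t)) \<partial>M)"
        by (rule Bochner_Integration.integral_sum[symmetric]) (intro integrable_norm int)
      also have "\<dots> \<le> (\<integral>t. \<bar>f t\<bar> \<partial>M)"
      proof (rule integral_mono)
        show "integrable M (\<lambda>t. \<Sum>n<m. norm (indicator (A n) t *\<^sub>R f t))"
          by (intro Bochner_Integration.integrable_sum integrable_norm int)
        show "(\<Sum>n<m. norm (indicator (A n) t *\<^sub>R f t)) \<le> \<bar>f t\<bar>" for t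
          by (auto simp: abs_mult sum_distrib_right[symmetric] ind
            intro!: mult_left_le_one_le split: split_indicator)
      qed (use f in simp)
      finally show ?thesis .
    qed
  qed simp
  from sums_integral[OF int _ this] pointwise_norm pointwise show ?thesis
    by (simp add: set_lebesgue_integral_def sums_iff)
qed

lemma set_integral_near_constant:
  fixes u :: "real \<Rightarrow> real"
  assumes u: "integrable lborel u" and "a \<le> b"
    and near: "\<And>t. t \<in> {a..<b} \<Longrightarrow> \<bar>u t - c\<bar> \<le> d"
  shows "\<bar>(LINT t:{a..<b}|lborel. u t) - (b - a) * c\<bar> \<le> (b - a) * d"
proof -
  have int: "integrable lborel (\<lambda>t. indicator {a..<b} t *\<^sub>R u t)"
    by (rule integrable_mult_indicator) (use u in auto)
  have const: "integrable lborel (\<lambda>t. indicator {a..<b} t *\<^sub>R k)"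
    "(\<integral>t. indicator {a..<b} t *\<^sub>R k \<partial>lborel) = (b - a) * k" for k :: real
    using \<open>a \<le> b\<close> by (auto simp: emeasure_lborel_Ico)
  have "(LINT t:{a..<b}|lborel. u t) - (b - a) * c
      = (\<integral>t. indicator {a..<b} t *\<^sub>R u t - indicator {a..<b} t *\<^sub>R c \<partial>lborel)"
    unfolding set_lebesgue_integral_def const(2)[symmetric]
    by (rule Bochner_Integration.integral_diff[symmetric]) (fact int const)+
  also have "\<bar>\<dots>\<bar> \<le> (\<integral>t. \<bar>indicator {a..<b} t *\<^sub>R u t - indicator {a..<b} t *\<^sub>R c\<bar> \<partial>lborel)"
    by (rule integral_abs_bound)
  also have "\<dots> \<le> (\<integral>t. indicator {a..<b} t *\<^sub>R d \<partial>lborel)"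
    by (intro integral_mono integrable_abs Bochner_Integration.integrable_diff int const)
      (use near in \<open>auto split: split_indicator\<close>)
  finally show ?thesis unfolding const(2) .
qed

text \<open>
  On a cell, \<open>g\<close> differs from its value at the left end by at most the integral of \<open>|g'|\<close> over the
  cell. Only absolute continuity of \<open>g\<close> enters, in the form of the integral representation \<open>prim\<close>.
\<close>
lemma cell_deviation:
  fixes g g' :: "real \<Rightarrow> real"
  assumes g: "integrable lborel g" and g': "integrable lborel g'" and "a \<le> b"
    and prim: "\<And>s t. s \<le> t \<Longrightarrow> g t - g s = (LINT y:{s..t}|lborel. g' y)"
  shows "\<bar>(LINT t:{a..<b}|lborel. g t) - (b - a) * g a\<bar> \<le> (b - a) * (LINT t:{a..<b}|lborel. \<bar>g' t\<bar>)"
    and "\<bar>(LINT t:{a..<b}|lborel. \<bar>g t\<bar>) - \<bar>(b - a) * g a\<bar>\<bar> \<le> (b - a) * (LINT t:{a..<b}|lborel. \<bar>g' t\<bar>)"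
proof -
  let ?d = "LINT t:{a..<b}|lborel. \<bar>g' t\<bar>"
  have near: "\<bar>g t - g a\<bar> \<le> ?d" if "t \<in> {a..<b}" for t
  proof -
    have "\<bar>g t - g a\<bar> \<le> (\<integral>y. \<bar>indicator {a..t} y *\<^sub>R g' y\<bar> \<partial>lborel)"
      using prim[of a t] that unfolding set_lebesgue_integral_def by simp
    also have "\<dots> \<le> ?d"
      unfolding set_lebesgue_integral_def
      by (intro integral_mono integrable_abs integrable_mult_indicator g')
        (use that in \<open>auto split: split_indicator\<close>)
    finally show ?thesis .
  qed
  then have near': "\<bar>\<bar>g t\<bar> - \<bar>g a\<bar>\<bar> \<le> ?d" if "t \<in> {a..<b}" for t
    using that abs_triangle_ineq3[of "g t" "g a"] by (meson order_trans)
  show "\<bar>(LINT t:{a..<b}|lborel. g t) - (b - a) * g a\<bar> \<le> (b - a) * ?d"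
    by (rule set_integral_near_constant[OF g \<open>a \<le> b\<close> near])
  show "\<bar>(LINT t:{a..<b}|lborel. \<bar>g t\<bar>) - \<bar>(b - a) * g a\<bar>\<bar> \<le> (b - a) * ?d"
    using set_integral_near_constant[OF integrable_abs[OF g] \<open>a \<le> b\<close> near'] \<open>a \<le> b\<close>
    by (simp add: abs_mult)
qed

text \<open>
  If the mesh is small compared with the Bernstein constant \<open>K\<close>, the error of the Riemann sum
  \<open>\<Sum>\<^sub>k w\<^sub>k g(x\<^sub>k)\<close> is at most half of \<open>\<Sum>\<^sub>k w\<^sub>k |g(x\<^sub>k)|\<close>. It is thus a functional on sample
  sequences of norm at most \<open>1/2\<close>, which can be absorbed into the weights without destroying their positivity.
  The bound \<open>1/3\<close> on \<open>\<rho> K\<close> is what produces the norm \<open>(1/3) / (1 - 1/3) = 1/2\<close>.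
\<close>
proposition positive_quadrature_from_Bernstein:
  fixes W :: "(real \<Rightarrow> real) set" and x :: "int \<Rightarrow> real"
  assumes lin: "\<And>g h a. g \<in> W \<Longrightarrow> h \<in> W \<Longrightarrow> (\<lambda>t. a * g t + h t) \<in> W"
    and int: "\<And>g. g \<in> W \<Longrightarrow> integrable lborel g"
    and Bernstein: "\<And>g. g \<in> W \<Longrightarrow> \<exists>g'. integrable lborel g' \<and>
          (\<forall>s t. s \<le> t \<longrightarrow> g t - g s = (LINT y:{s..t}|lborel. g' y)) \<and>
          (\<integral>t. \<bar>g' t\<bar> \<partial>lborel) \<le> K * (\<integral>t. \<bar>g t\<bar> \<partial>lborel)"
    and x: "strict_mono x" and \<rho>: "0 < \<rho>" "\<rho> * K \<le> 1 / 3"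
    and gap: "\<And>k. \<rho> / 2 \<le> x (k + 1) - x k" "\<And>k. x (k + 1) - x k \<le> \<rho>"
  shows "\<exists>\<Lambda>. (\<forall>k. 1 / 4 * \<rho> \<le> \<Lambda> k \<and> \<Lambda> k \<le> 3 / 2 * \<rho>) \<and>
    (\<forall>g\<in>W. ((\<lambda>k. \<Lambda> k * g (x k)) has_sum (\<integral>t. g t \<partial>lborel)) UNIV)"
proof -
  define v where "v k = x (k + 1) - x k" for k
  define A where "A n = {x (int_decode n)..<x (int_decode n + 1)}" for n
  \<comment> \<open>The weighted samples, with the cells renumbered by natural numbers.\<close>
  define S where "S g n = v (int_decode n) * g (x (int_decode n))" for g :: "real \<Rightarrow> real" and n
  have v_nonneg: "0 \<le> v k" and v_le: "v k \<le> \<rho>" for k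
    using gap[of k] \<rho>(1) by (auto simp: v_def)
  have A_sets: "A n \<in> sets lborel" for n by (simp add: A_def)
  have A_disj: "disjoint_family A"
    unfolding disjoint_family_on_def A_def
    by (intro ballI impI cells_disjoint[OF x]) (simp add: int_decode_eq)
  have A_cover: "(\<Union>n. A n) = UNIV"
  proof -
    have "(\<Union>n. A n) = (\<Union>k\<in>range int_decode. {x k..<x (k + 1)})"
      unfolding A_def by (simp add: image_image)
    then show ?thesis
      using cells_cover[of "\<rho> / 2" x] \<rho>(1) gap(1) by (simp add: surj_int_decode)
  qed
  note sums = set_integral_sums[OF _ A_sets A_disj A_cover]
  have key: "summable (\<lambda>n. \<bar>S g n\<bar>) \<and>
      \<bar>(\<integral>t. g t \<partial>lborel) - (\<Sum>n. S g n)\<bar> \<le> 1 / 2 * (\<Sum>n. \<bar>S g n\<bar>)" if g: "g \<in> W" for g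
  proof -
    obtain g' where g': "integrable lborel g'"
      and prim: "\<And>s t. s \<le> t \<Longrightarrow> g t - g s = (LINT y:{s..t}|lborel. g' y)"
      and bern: "(\<integral>t. \<bar>g' t\<bar> \<partial>lborel) \<le> K * (\<integral>t. \<bar>g t\<bar> \<partial>lborel)"
      using Bernstein[OF g] by blast
    define m where "m n = (LINT t:A n|lborel. g t)" for n
    define G where "G n = (LINT t:A n|lborel. \<bar>g t\<bar>)" for n
    define D where "D n = (LINT t:A n|lborel. \<bar>g' t\<bar>)" for n
    have m: "m sums (\<integral>t. g t \<partial>lborel)" unfolding m_def by (rule sums[OF int[OF g]])
    have G: "G sums (\<integral>t. \<bar>g t\<bar> \<partial>lborel)"
      unfolding G_def by (rule sums[OF integrable_abs[OF int[OF g]]])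
    have D: "D sums (\<integral>t. \<bar>g' t\<bar> \<partial>lborel)"
      unfolding D_def by (rule sums[OF integrable_abs[OF g']])
    have \<rho>D: "(\<lambda>n. \<rho> * D n) sums (\<rho> * (\<integral>t. \<bar>g' t\<bar> \<partial>lborel))"
      by (rule sums_mult[OF D])
    have D_nonneg: "0 \<le> D n" for n
      unfolding D_def set_lebesgue_integral_def by (intro integral_nonneg_AE) auto
    have "v (int_decode n) * D n \<le> \<rho> * D n" for n
      by (rule mult_right_mono[OF v_le D_nonneg])
    moreover have "\<bar>m n - S g n\<bar> \<le> v (int_decode n) * D n"
        "\<bar>G n - \<bar>S g n\<bar>\<bar> \<le> v (int_decode n) * D n" for n
      unfolding m_def G_def D_def S_def A_def v_def
      using v_nonneg[of "int_decode n"]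
      by (auto intro!: cell_deviation[OF int[OF g] g' _ prim] simp: v_def)
    ultimately have dev: "\<bar>m n - S g n\<bar> \<le> \<rho> * D n" "\<bar>G n - \<bar>S g n\<bar>\<bar> \<le> \<rho> * D n" for n
      by (meson order_trans)+
    have G\<rho>D: "summable (\<lambda>n. G n + \<rho> * D n)"
      using sums_add[OF G \<rho>D] by (rule sums_summable)
    have S_abs: "summable (\<lambda>n. \<bar>S g n\<bar>)"
    proof (rule summable_comparison_test'[OF G\<rho>D, of 0])
      show "norm \<bar>S g n\<bar> \<le> G n + \<rho> * D n" for n
        unfolding real_norm_def abs_idempotent using dev(2)[of n] by linarith
    qed
    have S_sum: "summable (S g)" using S_abs by (rule summable_rabs_cancel)
    have step: "\<rho> * (\<integral>t. \<bar>g' t\<bar> \<partial>lborel) \<le> 1 / 3 * (\<integral>t. \<bar>g t\<bar> \<partial>lborel)"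
    proof -
      have "\<rho> * (\<integral>t. \<bar>g' t\<bar> \<partial>lborel) \<le> \<rho> * (K * (\<integral>t. \<bar>g t\<bar> \<partial>lborel))"
        using bern \<rho>(1) by (intro mult_left_mono) auto
      also have "\<dots> = (\<rho> * K) * (\<integral>t. \<bar>g t\<bar> \<partial>lborel)" by simp
      also have "\<dots> \<le> 1 / 3 * (\<integral>t. \<bar>g t\<bar> \<partial>lborel)"
        by (rule mult_right_mono[OF \<rho>(2)]) simp
      finally show ?thesis .
    qed
    have "(\<integral>t. \<bar>g t\<bar> \<partial>lborel) \<le> (\<Sum>n. \<bar>S g n\<bar>) + \<rho> * (\<integral>t. \<bar>g' t\<bar> \<partial>lborel)"
    proof (rule sums_le[OF _ G sums_add[OF summable_sums[OF S_abs] \<rho>D]])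
      show "G n \<le> \<bar>S g n\<bar> + \<rho> * D n" for n using dev(2)[of n] by linarith
    qed
    \<comment> \<open>The samples control the norm: this is the lower estimate for the step function.\<close>
    then have "2 / 3 * (\<integral>t. \<bar>g t\<bar> \<partial>lborel) \<le> (\<Sum>n. \<bar>S g n\<bar>)" using step by linarith
    moreover have "\<bar>(\<integral>t. g t \<partial>lborel) - (\<Sum>n. S g n)\<bar> \<le> \<rho> * (\<integral>t. \<bar>g' t\<bar> \<partial>lborel)"
    proof -
      have diff: "(\<lambda>n. m n - S g n) sums ((\<integral>t. g t \<partial>lborel) - (\<Sum>n. S g n))"
        by (intro sums_diff m summable_sums S_sum)
      have "(\<integral>t. g t \<partial>lborel) - (\<Sum>n. S g n) \<le> \<rho> * (\<integral>t. \<bar>g' t\<bar> \<partial>lborel)"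
        by (rule sums_le[OF _ diff \<rho>D]) (use dev(1) in \<open>simp add: abs_le_iff\<close>)
      moreover have "- ((\<integral>t. g t \<partial>lborel) - (\<Sum>n. S g n)) \<le> \<rho> * (\<integral>t. \<bar>g' t\<bar> \<partial>lborel)"
        by (rule sums_le[OF _ sums_minus[OF diff] \<rho>D]) (use dev(1) in \<open>simp add: abs_le_iff\<close>)
      ultimately show ?thesis by linarith
    qed
    ultimately have "\<bar>(\<integral>t. g t \<partial>lborel) - (\<Sum>n. S g n)\<bar> \<le> 1 / 2 * (\<Sum>n. \<bar>S g n\<bar>)"
      using step by linarith
    with S_abs show ?thesis by blast
  qed
  have S_summable: "summable (S g)" if "g \<in> W" for g
    using key[OF that] summable_rabs_cancel by blast
  define U where "U = (\<lambda>g. (S g, (\<integral>t. g t \<partial>lborel) - (\<Sum>n. S g n))) ` W"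
  obtain e where e_le: "\<And>n. \<bar>e n\<bar> \<le> 1 / 2" and e: "\<And>s r. (s, r) \<in> U \<Longrightarrow> (\<lambda>n. e n * s n) sums r"
  proof (rule l1_functional_extension[of U "1 / 2"])
    fix s r s' r' and a :: real assume "(s, r) \<in> U" "(s', r') \<in> U"
    then obtain g h where g: "g \<in> W" "s = S g" "r = (\<integral>t. g t \<partial>lborel) - (\<Sum>n. S g n)"
      and h: "h \<in> W" "s' = S h" "r' = (\<integral>t. h t \<partial>lborel) - (\<Sum>n. S h n)"
      unfolding U_def by auto
    have S_lin: "S (\<lambda>t. a * g t + h t) = (\<lambda>n. a * S g n + S h n)"
      by (rule ext) (simp add: S_def algebra_simps)
    have "(\<Sum>n. a * S g n + S h n) = a * (\<Sum>n. S g n) + (\<Sum>n. S h n)"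
      by (intro sums_unique[symmetric] sums_add sums_mult summable_sums S_summable g(1) h(1))
    then have "(\<lambda>n. a * s n + s' n, a * r + r')
        = (S (\<lambda>t. a * g t + h t), (\<integral>t. a * g t + h t \<partial>lborel) - (\<Sum>n. S (\<lambda>t. a * g t + h t) n))"
      using int[OF g(1)] int[OF h(1)] unfolding S_lin g(2,3) h(2,3) by (simp add: algebra_simps)
    then show "(\<lambda>n. a * s n + s' n, a * r + r') \<in> U"
      using lin[OF g(1) h(1), of a] unfolding U_def by blast
  qed (use key in \<open>auto simp: U_def\<close>)
  define \<Lambda> where "\<Lambda> k = v k * (1 + e (int_encode k))" for k
  have "1 / 4 * \<rho> \<le> \<Lambda> k \<and> \<Lambda> k \<le> 3 / 2 * \<rho>" for k
  proof
    have e1: "1 / 2 \<le> 1 + e (int_encode k)" "1 + e (int_encode k) \<le> 3 / 2"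
      using e_le[of "int_encode k"] by auto
    have "\<rho> / 2 * (1 / 2) \<le> v k * (1 + e (int_encode k))"
      by (intro mult_mono) (use e1 gap(1)[of k] \<rho>(1) in \<open>auto simp: v_def\<close>)
    then show "1 / 4 * \<rho> \<le> \<Lambda> k" by (simp add: \<Lambda>_def)
    have "v k * (1 + e (int_encode k)) \<le> \<rho> * (3 / 2)"
      by (intro mult_mono) (use e1 v_le \<rho>(1) in auto)
    then show "\<Lambda> k \<le> 3 / 2 * \<rho>" by (simp add: \<Lambda>_def)
  qed
  moreover have "((\<lambda>k. \<Lambda> k * g (x k)) has_sum (\<integral>t. g t \<partial>lborel)) UNIV" if g: "g \<in> W" for g
  proof -
    have eq: "\<Lambda> (int_decode n) * g (x (int_decode n)) = S g n + e n * S g n" for n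
      by (simp add: \<Lambda>_def S_def algebra_simps)
    have "(\<lambda>n. e n * S g n) sums ((\<integral>t. g t \<partial>lborel) - (\<Sum>n. S g n))"
      by (rule e) (use g in \<open>auto simp: U_def\<close>)
    from sums_add[OF summable_sums[OF S_summable[OF g]] this]
    have sum: "(\<lambda>n. S g n + e n * S g n) sums (\<integral>t. g t \<partial>lborel)" by simp
    have bound: "norm (norm (S g n + e n * S g n)) \<le> 3 / 2 * \<bar>S g n\<bar>" for n
    proof -
      have "\<bar>S g n + e n * S g n\<bar> = \<bar>1 + e n\<bar> * \<bar>S g n\<bar>"
        by (simp add: abs_mult[symmetric] algebra_simps)
      also have "\<dots> \<le> 3 / 2 * \<bar>S g n\<bar>"
        by (rule mult_right_mono) (use e_le[of n] in auto)
      finally show ?thesis by simp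
    qed
    have "summable (\<lambda>n. norm (S g n + e n * S g n))"
      by (rule summable_comparison_test'[OF summable_mult[of "\<lambda>n. \<bar>S g n\<bar>"] bound])
        (use key[OF g] in simp)
    from norm_summable_imp_has_sum[OF this sum]
    have "((\<lambda>n. \<Lambda> (int_decode n) * g (x (int_decode n))) has_sum (\<integral>t. g t \<partial>lborel)) UNIV"
      unfolding eq .
    then show ?thesis
      using has_sum_reindex_bij_betw[OF bij_int_decode, of "\<lambda>k. \<Lambda> k * g (x k)"] by simp
  qed
  ultimately show ?thesis by blast
qed

section \<open>The arcsine series at the endpoint\<close>

text \<open>
  Integrating the binomial series of \<open>(1 - x\<^sup>2)\<^sup>-\<^sup>1\<^sup>/\<^sup>2\<close> termwise gives the arcsine. As all coefficients are
  nonnegative, partial sums at \<open>x < 1\<close> stay below \<open>arcsin x \<le> \<pi>/2\<close>, and letting \<open>x \<rightarrow> 1\<close> bounds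
  the sum of the coefficients.
\<close>
lemma arcsin_series_coefficients:
  defines "b \<equiv> (\<lambda>n. \<bar>(- 1 / 2 :: real) gchoose n\<bar>)"
  shows "\<bar>x\<bar> < 1 \<Longrightarrow> (\<lambda>n. b n / real (2 * n + 1) * x ^ (2 * n + 1)) sums arcsin x"
    and "summable (\<lambda>n. b n / real (2 * n + 1))"
    and "(\<Sum>n. b n / real (2 * n + 1)) \<le> pi / 2"
proof -
  \<comment> \<open>The coefficients as a full power series, as termwise differentiation requires.\<close>
  define f where "f m = (if even m then b (m div 2) / real (m + 1) else 0)" for m
  have b_eq: "(- 1 / 2 gchoose n) * (- z) ^ n = b n * z ^ n" for n and z :: real
  proof -
    have "b n = pochhammer (1 / 2) n / fact n"
      unfolding b_def gbinomial_pochhammer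
      by (simp add: abs_mult power_abs pochhammer_nonneg)
    moreover have "(- 1) ^ n * (- z) ^ n = z ^ n"
      by (simp add: power_mult_distrib[symmetric])
    ultimately show ?thesis
      unfolding gbinomial_pochhammer by (simp add: mult.commute mult.left_commute)
  qed
  have binom: "(\<lambda>n. b n * z ^ n) sums (1 - z) powr (- 1 / 2)" if "\<bar>z\<bar> < 1" for z
    using gen_binomial_real[of "- z" "- 1 / 2"] that unfolding b_eq by simp
  have b_nonneg: "0 \<le> b n" for n by (simp add: b_def)
  have powr_eq: "(1 - x\<^sup>2) powr (- 1 / 2) = inverse (sqrt (1 - x\<^sup>2))" if "\<bar>x\<bar> < 1" for x :: real
    using that powr_minus[of "1 - x\<^sup>2" "1 / 2"] powr_half_sqrt[of "1 - x\<^sup>2"]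
    by (simp add: abs_square_le_1)
  have square_series: "(\<lambda>n. b n * x ^ (2 * n)) sums inverse (sqrt (1 - x\<^sup>2))" if x: "\<bar>x\<bar> < 1" for x
    using binom[of "x\<^sup>2"] x unfolding powr_eq[OF x] by (simp add: abs_square_less_1 power_mult)
  have deriv_series: "(\<lambda>m. f m * real (Suc m) * x ^ m) sums inverse (sqrt (1 - x\<^sup>2))"
    if x: "\<bar>x\<bar> < 1" for x
  proof -
    have eq: "(\<lambda>m. f m * real (Suc m) * x ^ m) = (\<lambda>m. if even m then b (m div 2) * x ^ (2 * (m div 2)) else 0)"
      by (auto simp: f_def fun_eq_iff)
    show ?thesis
      unfolding eq using sums_if[OF sums_zero square_series[OF x]] by simp
  qed
  have term_summable: "summable (\<lambda>n. b n / real (2 * n + 1) * x ^ (2 * n + 1))" if x: "\<bar>x\<bar> < 1" for x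
  proof (rule summable_comparison_test'[OF sums_summable[OF square_series[OF x]], of 0])
    fix n :: nat
    have "b n * 1 \<le> b n * real (2 * n + 1)"
      by (rule mult_left_mono) (use b_nonneg in auto)
    then have "b n / real (2 * n + 1) \<le> b n" by (simp add: divide_le_eq)
    then have "b n / real (2 * n + 1) * (\<bar>x\<bar> * x ^ (2 * n)) \<le> b n * (1 * x ^ (2 * n))"
      by (intro mult_mono) (use x b_nonneg[of n] in \<open>auto intro!: mult_right_mono mult_nonneg_nonneg\<close>)
    then show "norm (b n / real (2 * n + 1) * x ^ (2 * n + 1)) \<le> b n * x ^ (2 * n)"
      using b_nonneg[of n] by (simp add: abs_mult power_abs power_even_abs)
  qed
  have interleave: "(\<lambda>m. f m * x ^ Suc m) sums (\<Sum>n. b n / real (2 * n + 1) * x ^ (2 * n + 1))"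
    if x: "\<bar>x\<bar> < 1" for x
  proof -
    have eq: "(\<lambda>m. f m * x ^ Suc m)
        = (\<lambda>m. if even m then b (m div 2) / real (2 * (m div 2) + 1) * x ^ (2 * (m div 2) + 1) else 0)"
      by (auto simp: f_def fun_eq_iff)
    show ?thesis
      unfolding eq using sums_if[OF sums_zero summable_sums[OF term_summable[OF x]]] by simp
  qed
  define F where "F x = (\<Sum>m. f m * x ^ Suc m)" for x
  have F_deriv: "((\<lambda>x. F x - arcsin x) has_real_derivative 0) (at x)" if x: "x \<in> {-1<..<1}" for x
  proof -
    have "(F has_real_derivative (\<Sum>m. f m * real (Suc m) * x ^ m)) (at x)"
      unfolding F_def
    proof (rule DERIV_power_series'[OF _ x])
      show "summable (\<lambda>m. f m * real (Suc m) * z ^ m)" if "z \<in> {-1<..<1}" for z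
        by (rule sums_summable[OF deriv_series]) (use that in auto)
    qed simp
    moreover have "(\<Sum>m. f m * real (Suc m) * x ^ m) = inverse (sqrt (1 - x\<^sup>2))"
      by (rule sums_unique[symmetric, OF deriv_series]) (use x in auto)
    moreover have "(arcsin has_real_derivative inverse (sqrt (1 - x\<^sup>2))) (at x)"
      using x by (intro DERIV_arcsin) auto
    ultimately have "((\<lambda>x. F x - arcsin x) has_real_derivative
        inverse (sqrt (1 - x\<^sup>2)) - inverse (sqrt (1 - x\<^sup>2))) (at x)"
      by (intro DERIV_diff) simp_all
    then show ?thesis by simp
  qed
  show A: "(\<lambda>n. b n / real (2 * n + 1) * x ^ (2 * n + 1)) sums arcsin x" if x: "\<bar>x\<bar> < 1" for x
  proof -
    have "F x - arcsin x = F 0 - arcsin 0"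
      by (rule DERIV_isconst3[of "-1" 1]) (use x F_deriv in auto)
    then have "F x = arcsin x" by (simp add: F_def)
    then show ?thesis
      using interleave[OF x] summable_sums[OF term_summable[OF x]] by (simp add: F_def sums_iff)
  qed
  have partial: "(\<Sum>n<N. b n / real (2 * n + 1)) \<le> pi / 2" for N
  proof -
    have "((\<lambda>x. \<Sum>n<N. b n / real (2 * n + 1) * x ^ (2 * n + 1)) \<longlongrightarrow>
        (\<Sum>n<N. b n / real (2 * n + 1) * 1 ^ (2 * n + 1))) (at_left 1)"
      by (intro tendsto_intros)
    moreover have "\<forall>\<^sub>F x in at_left 1. (\<Sum>n<N. b n / real (2 * n + 1) * x ^ (2 * n + 1)) \<le> pi / 2"
    proof (rule eventually_mono)
      show "\<forall>\<^sub>F x in at_left 1. x \<in> {0<..<1::real}"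
        by (rule eventually_at_left_real) simp
      fix x :: real assume elim: "x \<in> {0<..<1}"
      then have x: "\<bar>x\<bar> < 1" by auto
      have "(\<Sum>n<N. b n / real (2 * n + 1) * x ^ (2 * n + 1)) \<le> (\<Sum>n. b n / real (2 * n + 1) * x ^ (2 * n + 1))"
        by (rule sum_le_suminf) (use A[OF x] elim b_nonneg in \<open>auto intro: sums_summable\<close>)
      also have "\<dots> = arcsin x" by (rule sums_unique[symmetric, OF A[OF x]])
      also have "\<dots> \<le> pi / 2" using arcsin_ubound[of x] x by simp
      finally show "(\<Sum>n<N. b n / real (2 * n + 1) * x ^ (2 * n + 1)) \<le> pi / 2" .
    qed
    ultimately show ?thesis
      using tendsto_upperbound[of _ _ "at_left (1::real)" "pi / 2"] by simp
  qed
  then show summ: "summable (\<lambda>n. b n / real (2 * n + 1))"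
    by (intro summableI_nonneg_bounded[where x = "pi / 2"]) (use b_nonneg in simp_all)
  show "(\<Sum>n. b n / real (2 * n + 1)) \<le> pi / 2"
    using summ partial by (rule suminf_le_const)
qed

text \<open>
  The identity \<open>\<theta> = arcsin (sin \<theta>)\<close>, multiplied by \<open>\<i>\<close>. It is stated in powers of \<open>\<i> sin \<theta>\<close>, the multiplier
  of a central difference, because then the coefficients are real and real functions are kept
  real. The sum of the coefficients controls an \<open>L\<^sub>1\<close>-operator norm, hence the need for
  convergence at the endpoint \<open>1\<close> of the arcsine series.
\<close>
lemma imaginary_sine_series:
  obtains a :: "nat \<Rightarrow> real"
  where "summable (\<lambda>n. \<bar>a n\<bar>)" and "(\<Sum>n. \<bar>a n\<bar>) \<le> 2"
    and "\<And>\<theta>. \<bar>\<theta>\<bar> \<le> 1 \<Longrightarrow> (\<lambda>n. of_real (a n) * (\<i> * of_real (sin \<theta>)) ^ Suc n) sums (\<i> * of_real \<theta>)"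
proof -
  define c where "c n = \<bar>(- 1 / 2 :: real) gchoose n\<bar> / real (2 * n + 1)" for n
  note c = arcsin_series_coefficients[folded c_def]
  define a where "a n = (if even n then (- 1) ^ (n div 2) * c (n div 2) else 0)" for n
  have "(\<lambda>n. \<bar>a n\<bar>) = (\<lambda>n. if even n then c (n div 2) else 0)"
    by (auto simp: a_def c_def abs_mult)
  then have abs_a: "(\<lambda>n. \<bar>a n\<bar>) sums (\<Sum>n. c n)"
    using sums_if[OF sums_zero summable_sums[OF c(2)]] by simp
  show thesis
  proof (rule that)
    show "summable (\<lambda>n. \<bar>a n\<bar>)" using abs_a by (rule sums_summable)
    show "(\<Sum>n. \<bar>a n\<bar>) \<le> 2"
      using c(3) pi_less_4 by (simp add: sums_unique[OF abs_a, symmetric])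
    fix \<theta> :: real assume \<theta>: "\<bar>\<theta>\<bar> \<le> 1"
    have half: "1 < pi / 2" using pi_gt3 by simp
    have "\<bar>sin \<theta>\<bar> < 1"
    proof -
      have "sin \<theta> < sin (pi / 2)" "sin (- (pi / 2)) < sin \<theta>"
        using \<theta> half by (intro sin_monotone_2pi; simp)+
      then show ?thesis by simp
    qed
    from c(1)[OF this] have "(\<lambda>n. c n * sin \<theta> ^ (2 * n + 1)) sums \<theta>"
      using arcsin_sin[of \<theta>] \<theta> half by simp
    from sums_if[OF sums_zero this]
    have "(\<lambda>n. if even n then c (n div 2) * sin \<theta> ^ (2 * (n div 2) + 1) else 0) sums \<theta>" by simp
    from sums_mult[OF sums_of_real[OF this], of \<i>]
    have "(\<lambda>n. \<i> * of_real (if even n then c (n div 2) * sin \<theta> ^ (2 * (n div 2) + 1) else 0)) sums (\<i> * of_real \<theta>)" .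
    moreover have "of_real (a n) * (\<i> * of_real (sin \<theta>)) ^ Suc n
        = \<i> * complex_of_real (if even n then c (n div 2) * sin \<theta> ^ (2 * (n div 2) + 1) else 0)" for n
    proof (cases "even n")
      case True
      then obtain k where k: "n = 2 * k" by (elim evenE)
      have "(- 1) ^ k * (\<i> ^ k)\<^sup>2 = (1 :: complex)"
        by (simp add: power2_eq_square flip: power_mult_distrib)
      then show ?thesis
        by (simp add: k a_def power_mult_distrib power_mult algebra_simps)
    qed (simp add: a_def)
    ultimately show "(\<lambda>n. of_real (a n) * (\<i> * of_real (sin \<theta>)) ^ Suc n) sums (\<i> * of_real \<theta>)"
      by (simp only:)
  qed
qed

section \<open>Bernstein's inequality for integrable band-limited functions\<close>

text \<open>
  Real parts of Fourier integrals over \<open>[-\<omega>, \<omega>]\<close>. As \<open>Im z = Re (-\<i> z)\<close>, the space contains the imaginary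
  parts as well. Real functions suffice for constructing real weights.
\<close>
definition band_limited :: "real \<Rightarrow> (real \<Rightarrow> real) set" where
  "band_limited \<omega> = {g. integrable lborel g \<and>
     (\<exists>F. integrable lborel F \<and> (\<forall>l. \<omega> < \<bar>l\<bar> \<longrightarrow> F l = 0) \<and>
       (\<forall>y. g y = Re (\<integral>l. F l * cis (y * l) \<partial>lborel)))}"

definition central_difference :: "real \<Rightarrow> (real \<Rightarrow> real) \<Rightarrow> real \<Rightarrow> real" where
  "central_difference h g y = (g (y + h) - g (y - h)) / 2"

lemma borel_measurable_cis [measurable (raw)]:
  "f \<in> borel_measurable M \<Longrightarrow> (\<lambda>x. cis (f x)) \<in> borel_measurable M"
  by (rule measurable_compose[of f M borel cis], assumption)
    (intro borel_measurable_continuous_onI continuous_intros)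

lemma integrable_mult_bounded:
  fixes F :: "real \<Rightarrow> complex"
  assumes F: "integrable lborel F" and u: "u \<in> borel_measurable lborel"
    and "\<And>l. cmod (F l * u l) \<le> B * cmod (F l)"
  shows "integrable lborel (\<lambda>l. F l * u l)"
proof (rule Bochner_Integration.integrable_bound)
  show "integrable lborel (\<lambda>l. B * cmod (F l))" using F by simp
  show "(\<lambda>l. F l * u l) \<in> borel_measurable lborel"
    using borel_measurable_integrable[OF F] u by measurable
  show "AE l in lborel. norm (F l * u l) \<le> norm (B * cmod (F l))"
    using assms(3) by (intro AE_I2) (smt (verit, best) real_norm_def)
qed

lemma integral_shift:
  fixes g :: "real \<Rightarrow> real"
  assumes "integrable lborel g"
  shows "integrable lborel (\<lambda>y. g (y + h))" and "(\<integral>y. g (y + h) \<partial>lborel) = (\<integral>y. g y \<partial>lborel)"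
  using lborel_integrable_real_affine[OF assms, of 1 h] lborel_integral_real_affine[of 1 g h]
  by (simp_all add: add.commute)

lemma central_difference_L1:
  assumes g: "integrable lborel g"
  shows "integrable lborel (central_difference h g)"
    and "(\<integral>y. \<bar>central_difference h g y\<bar> \<partial>lborel) \<le> (\<integral>y. \<bar>g y\<bar> \<partial>lborel)"
proof -
  note shift = integral_shift[OF g, of h] integral_shift[OF g, of "- h", simplified]
    integral_shift[OF integrable_abs[OF g], of h] integral_shift[OF integrable_abs[OF g], of "- h", simplified]
  show "integrable lborel (central_difference h g)"
    unfolding central_difference_def using shift by simp
  then have "(\<integral>y. \<bar>central_difference h g y\<bar> \<partial>lborel) \<le> (\<integral>y. (\<bar>g (y + h)\<bar> + \<bar>g (y - h)\<bar>) / 2 \<partial>lborel)"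
    using shift by (intro integral_mono) (auto simp: central_difference_def)
  also have "\<dots> = (\<integral>y. \<bar>g y\<bar> \<partial>lborel)"
    using shift by simp
  finally show "(\<integral>y. \<bar>central_difference h g y\<bar> \<partial>lborel) \<le> (\<integral>y. \<bar>g y\<bar> \<partial>lborel)" .
qed

lemma central_difference_power_L1:
  assumes g: "integrable lborel g"
  shows "integrable lborel ((central_difference h ^^ m) g)
    \<and> (\<integral>y. \<bar>(central_difference h ^^ m) g y\<bar> \<partial>lborel) \<le> (\<integral>y. \<bar>g y\<bar> \<partial>lborel)"
proof (induction m)
  case (Suc m)
  then show ?case
    using central_difference_L1[of "(central_difference h ^^ m) g" h] by (auto intro: order_trans)
qed (use g in simp)

text \<open>
  Under the Fourier integral a shift by \<open>h\<close> is multiplication by \<open>cis (h l)\<close>, so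
  the central difference is multiplication by \<open>\<i> sin (h l)\<close>.
\<close>
lemma central_difference_power_multiplier:
  fixes F :: "real \<Rightarrow> complex"
  assumes F: "integrable lborel F"
    and g: "\<And>y. g y = Re (\<integral>l. F l * cis (y * l) \<partial>lborel)"
  shows "(central_difference h ^^ m) g y
    = Re (\<integral>l. F l * ((\<i> * of_real (sin (h * l))) ^ m * cis (y * l)) \<partial>lborel)"
proof (induction m arbitrary: y)
  case (Suc m)
  let ?u = "\<lambda>y l. (\<i> * of_real (sin (h * l))) ^ m * cis (y * l)"
  have int: "integrable lborel (\<lambda>l. F l * ?u y l)" for y
  proof (rule integrable_mult_bounded[OF F, where B = 1])
    have "cmod (?u y l) \<le> 1" for l
      by (simp add: norm_mult norm_power power_le_one)
    then show "cmod (F l * ?u y l) \<le> 1 * cmod (F l)" for l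
      unfolding norm_mult[of "F l"] by (simp add: mult_right_le_one_le)
  qed measurable
  have Re_eq: "Re a - Re b = 2 * Re c" if "a - b = 2 * c" for a b c :: complex
    using that by (simp add: complex_eq_iff)
  have "F l * ?u (y + h) l - F l * ?u (y - h) l
      = 2 * (F l * ((\<i> * of_real (sin (h * l))) ^ Suc m * cis (y * l)))" for l
  proof -
    have "cis ((y + h) * l) - cis ((y - h) * l) = 2 * (\<i> * of_real (sin (h * l))) * cis (y * l)"
      by (simp add: complex_eq_iff sin_add cos_add sin_diff cos_diff algebra_simps)
    then show ?thesis by (simp add: right_diff_distrib[symmetric] algebra_simps)
  qed
  then have "(\<integral>l. F l * ?u (y + h) l \<partial>lborel) - (\<integral>l. F l * ?u (y - h) l \<partial>lborel)
      = 2 * (\<integral>l. F l * ((\<i> * of_real (sin (h * l))) ^ Suc m * cis (y * l)) \<partial>lborel)"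
    by (simp add: Bochner_Integration.integral_diff[OF int int, symmetric])
  then have "Re (\<integral>l. F l * ?u (y + h) l \<partial>lborel) - Re (\<integral>l. F l * ?u (y - h) l \<partial>lborel)
      = 2 * Re (\<integral>l. F l * ((\<i> * of_real (sin (h * l))) ^ Suc m * cis (y * l)) \<partial>lborel)"
    by (rule Re_eq)
  moreover have "(central_difference h ^^ Suc m) g y
      = ((central_difference h ^^ m) g (y + h) - (central_difference h ^^ m) g (y - h)) / 2"
    by (simp only: funpow.simps o_apply central_difference_def[of h "(central_difference h ^^ m) g"])
  ultimately show ?case by (simp only: Suc.IH)
qed (simp add: g)

text \<open>
  The bounded support makes \<open>l F(l)\<close> integrable, so that integrating the formal derivative
  over \<open>[s, t]\<close> is an exchange of integrals followed by the fundamental theorem for \<open>cis (y l)\<close>.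
\<close>
lemma derivative_of_Fourier_integral:
  fixes F :: "real \<Rightarrow> complex"
  assumes F: "integrable lborel F" and supp: "\<And>l. \<omega> < \<bar>l\<bar> \<Longrightarrow> F l = 0" and "s \<le> t"
  shows "(LINT y:{s..t}|lborel. Re (\<integral>l. F l * (\<i> * of_real l * cis (y * l)) \<partial>lborel))
    = Re (\<integral>l. F l * cis (t * l) \<partial>lborel) - Re (\<integral>l. F l * cis (s * l) \<partial>lborel)"
proof -
  note [measurable] = borel_measurable_integrable[OF F]
  \<comment> \<open>The integrand, extended by zero outside \<open>[s, t]\<close>.\<close>
  define k where "k l y = indicator {s..t} y *\<^sub>R (F l * (\<i> * of_real l * cis (y * l)))" for l y
  have norm_k: "norm (k l y) = indicator {s..t} y * (cmod (F l) * \<bar>l\<bar>)" for l y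
    by (simp add: k_def norm_mult)
  have bound: "cmod (F l) * \<bar>l\<bar> \<le> \<omega> * cmod (F l)" for l
    using supp[of l] by (cases "\<omega> < \<bar>l\<bar>") (auto simp: mult.commute intro: mult_right_mono)
  have int_Fl: "integrable lborel (\<lambda>l. F l * (\<i> * of_real l * cis (y * l)))" for y
    by (rule integrable_mult_bounded[OF F, where B = \<omega>]) (use bound in \<open>auto simp: norm_mult\<close>)
  have meas: "(\<lambda>(l, y). k l y) \<in> borel_measurable (lborel \<Otimes>\<^sub>M lborel)"
    unfolding k_def by measurable
  have int_k: "integrable (lborel \<Otimes>\<^sub>M lborel) (\<lambda>(l, y). k l y)"
  proof (rule lborel_pair.Fubini_integrable[OF meas])
    have "integrable lborel (\<lambda>l. (t - s) * cmod (F l * (\<i> * of_real l * cis (0 * l))))"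
      using int_Fl[of 0] by (intro integrable_mult_right integrable_norm)
    then show "integrable lborel (\<lambda>l. \<integral>y. norm (case (l, y) of (l, y) \<Rightarrow> k l y) \<partial>lborel)"
      using \<open>s \<le> t\<close> by (simp add: norm_k norm_mult)
    show "AE l in lborel. integrable lborel (\<lambda>y. case (l, y) of (l, y) \<Rightarrow> k l y)"
      unfolding k_def prod.case
      by (intro AE_I2 borel_integrable_compact continuous_intros) simp
  qed
  have inner: "(\<integral>y. k l y \<partial>lborel) = F l * cis (t * l) - F l * cis (s * l)" for l
    unfolding k_def
  proof (rule integral_FTC_atLeastAtMost[OF \<open>s \<le> t\<close>])
    show "((\<lambda>y. F l * cis (y * l)) has_vector_derivative F l * (\<i> * of_real l * cis (y * l)))
        (at y within {s..t})" for y
      unfolding has_vector_derivative_def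
      by (auto intro!: derivative_eq_intros simp: scaleR_conv_of_real algebra_simps)
  qed (intro continuous_intros)
  have int_F: "integrable lborel (\<lambda>l. F l * cis (y * l))" for y
    by (rule integrable_mult_bounded[OF F, where B = 1]) (auto simp: norm_mult)
  have "(LINT y:{s..t}|lborel. Re (\<integral>l. F l * (\<i> * of_real l * cis (y * l)) \<partial>lborel))
      = (\<integral>y. Re (\<integral>l. k l y \<partial>lborel) \<partial>lborel)"
    unfolding set_lebesgue_integral_def k_def by (simp add: int_Fl)
  also have "\<dots> = Re (\<integral>y. (\<integral>l. k l y \<partial>lborel) \<partial>lborel)"
    by (rule integral_Re) (rule lborel_pair.integrable_snd[OF int_k])
  also have "\<dots> = Re (\<integral>l. (\<integral>y. k l y \<partial>lborel) \<partial>lborel)"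
    by (subst lborel_pair.Fubini_integral[OF int_k]) (rule refl)
  also have "\<dots> = Re ((\<integral>l. F l * cis (t * l) \<partial>lborel) - (\<integral>l. F l * cis (s * l) \<partial>lborel))"
    unfolding inner by (simp add: int_F)
  finally show ?thesis by simp
qed

text \<open>
  With step \<open>h = 1/\<omega>\<close> the argument \<open>h l\<close> stays in \<open>[-1, 1]\<close> on the support of \<open>F\<close>, so the sine series
  gives \<open>\<i> l = \<omega> \<Sum>\<^sub>n a\<^sub>n (\<i> sin (h l))\<^sup>n\<^sup>+\<^sup>1\<close> there, that is \<open>g' = \<omega> \<Sum>\<^sub>n a\<^sub>n \<Delta>\<^sup>n\<^sup>+\<^sup>1 g\<close> with the
  central difference \<open>\<Delta>\<close>. As \<open>\<Delta>\<close> is a contraction of \<open>L\<^sub>1\<close> and \<open>\<Sum>\<^sub>n |a\<^sub>n| \<le> 2\<close>, the bound follows.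
  The classical constant is \<open>\<omega>\<close>; the factor \<open>2\<close> comes from estimating the sum of the coefficients, which
  is \<open>\<pi>/2\<close>.
\<close>
proposition Bernstein_inequality_L1:
  assumes "0 < \<omega>" and "g \<in> band_limited \<omega>"
  shows "\<exists>g'. integrable lborel g' \<and>
    (\<forall>s t. s \<le> t \<longrightarrow> g t - g s = (LINT y:{s..t}|lborel. g' y)) \<and>
    (\<integral>y. \<bar>g' y\<bar> \<partial>lborel) \<le> 2 * \<omega> * (\<integral>y. \<bar>g y\<bar> \<partial>lborel)"
proof -
  obtain F where g: "integrable lborel g" and F: "integrable lborel F"
    and supp: "\<And>l. \<omega> < \<bar>l\<bar> \<Longrightarrow> F l = 0"
    and rep: "\<And>y. g y = Re (\<integral>l. F l * cis (y * l) \<partial>lborel)"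
    using assms(2) unfolding band_limited_def by auto
  obtain a :: "nat \<Rightarrow> real" where a: "summable (\<lambda>n. \<bar>a n\<bar>)" "(\<Sum>n. \<bar>a n\<bar>) \<le> 2"
    and sine: "\<And>\<theta>. \<bar>\<theta>\<bar> \<le> 1 \<Longrightarrow> (\<lambda>n. of_real (a n) * (\<i> * of_real (sin \<theta>)) ^ Suc n) sums (\<i> * of_real \<theta>)"
    using imaginary_sine_series by blast
  define h where "h = 1 / \<omega>"
  define d where "d n = (central_difference h ^^ Suc n) g" for n
  define f where "f n y = \<omega> * a n * d n y" for n y
  \<comment> \<open>The spectral side of \<open>f n y\<close>.\<close>
  define \<phi> where "\<phi> y n l = F l * (of_real \<omega> * of_real (a n) * (\<i> * of_real (sin (h * l))) ^ Suc n * cis (y * l))" for y n l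
  define g' where "g' y = Re (\<integral>l. F l * (\<i> * of_real l * cis (y * l)) \<partial>lborel)" for y
  have norm_\<phi>: "cmod (\<phi> y n l) \<le> \<omega> * \<bar>a n\<bar> * cmod (F l)" for y n l
  proof -
    have "cmod ((\<i> * of_real (sin (h * l))) ^ Suc n) \<le> 1"
      unfolding norm_power norm_mult by (rule power_le_one) auto
    then have "(\<omega> * \<bar>a n\<bar> * cmod (F l)) * cmod ((\<i> * of_real (sin (h * l))) ^ Suc n) \<le> \<omega> * \<bar>a n\<bar> * cmod (F l)"
      using assms(1) by (intro mult_right_le_one_le) auto
    then show ?thesis
      using assms(1) unfolding \<phi>_def norm_mult by (simp add: algebra_simps)
  qed
  have int_\<phi>: "integrable lborel (\<phi> y n)" for y n
    unfolding \<phi>_def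
    by (rule integrable_mult_bounded[OF F, where B = "\<omega> * \<bar>a n\<bar>"])
      (use norm_\<phi> in \<open>auto simp: \<phi>_def\<close>)
  have f_eq: "f n y = Re (\<integral>l. \<phi> y n l \<partial>lborel)" for n y
  proof -
    have "(\<integral>l. \<phi> y n l \<partial>lborel)
        = of_real (\<omega> * a n) * (\<integral>l. F l * ((\<i> * of_real (sin (h * l))) ^ Suc n * cis (y * l)) \<partial>lborel)"
      unfolding \<phi>_def integral_mult_right_zero[symmetric]
      by (intro Bochner_Integration.integral_cong) (auto simp: algebra_simps)
    then show ?thesis
      unfolding f_def d_def central_difference_power_multiplier[OF F rep] by simp
  qed
  have sum_a: "summable (\<lambda>n. \<omega> * \<bar>a n\<bar> * c)" for c
    by (intro summable_mult summable_mult2 a(1))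
  have sums_g': "(\<lambda>n. f n y) sums g' y" for y
  proof -
    have pointwise: "(\<lambda>n. \<phi> y n l) sums (F l * (\<i> * of_real l * cis (y * l)))" for l
    proof (cases "\<omega> < \<bar>l\<bar>")
      case False
      then have "\<bar>h * l\<bar> \<le> 1" using assms(1) by (simp add: h_def abs_mult)
      from sums_mult[OF sine[OF this], of "F l * of_real \<omega> * cis (y * l)"]
      show ?thesis
        using assms(1) by (simp add: \<phi>_def h_def algebra_simps)
    qed (simp add: supp \<phi>_def)
    have "(\<lambda>n. \<integral>l. \<phi> y n l \<partial>lborel) sums (\<integral>l. (\<Sum>n. \<phi> y n l) \<partial>lborel)"
    proof (rule sums_integral[OF int_\<phi>])
      show "AE l in lborel. summable (\<lambda>n. norm (\<phi> y n l))"
        by (intro AE_I2 summable_comparison_test'[OF sum_a]) (use norm_\<phi> in auto)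
      show "summable (\<lambda>n. \<integral>l. norm (\<phi> y n l) \<partial>lborel)"
      proof (rule summable_comparison_test'[OF sum_a, of 0 _ "\<integral>l. cmod (F l) \<partial>lborel"])
        fix n
        have "(\<integral>l. norm (\<phi> y n l) \<partial>lborel) \<le> (\<integral>l. \<omega> * \<bar>a n\<bar> * cmod (F l) \<partial>lborel)"
          by (intro integral_mono integrable_norm int_\<phi> integrable_mult_right F norm_\<phi>)
        then show "norm (\<integral>l. norm (\<phi> y n l) \<partial>lborel) \<le> \<omega> * \<bar>a n\<bar> * (\<integral>l. cmod (F l) \<partial>lborel)"
          by simp
      qed
    qed
    from sums_Re[OF this] show ?thesis
      unfolding f_eq g'_def by (simp add: sums_unique[OF pointwise, symmetric])
  qed
  have d_int: "integrable lborel (d n)" and d_L1: "(\<integral>y. \<bar>d n y\<bar> \<partial>lborel) \<le> (\<integral>y. \<bar>g y\<bar> \<partial>lborel)" for n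
    unfolding d_def using central_difference_power_L1[OF g] by blast+
  have f_int: "integrable lborel (f n)" for n
    unfolding f_def by (intro integrable_mult_right d_int)
  have f_L1: "(\<integral>y. \<bar>f n y\<bar> \<partial>lborel) \<le> \<omega> * \<bar>a n\<bar> * (\<integral>y. \<bar>g y\<bar> \<partial>lborel)" for n
  proof -
    have "(\<integral>y. \<bar>f n y\<bar> \<partial>lborel) = \<omega> * \<bar>a n\<bar> * (\<integral>y. \<bar>d n y\<bar> \<partial>lborel)"
      using assms(1) by (simp add: f_def abs_mult)
    also have "\<dots> \<le> \<omega> * \<bar>a n\<bar> * (\<integral>y. \<bar>g y\<bar> \<partial>lborel)"
      using assms(1) by (intro mult_left_mono d_L1) auto
    finally show ?thesis .
  qed
  have f_abs_summable: "summable (\<lambda>n. \<bar>f n y\<bar>)" for y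
  proof (rule summable_comparison_test'[OF sum_a, of 0 _ "\<integral>l. cmod (F l) \<partial>lborel"])
    fix n
    have "\<bar>f n y\<bar> \<le> cmod (\<integral>l. \<phi> y n l \<partial>lborel)" unfolding f_eq by (rule abs_Re_le_cmod)
    also have "\<dots> \<le> (\<integral>l. \<omega> * \<bar>a n\<bar> * cmod (F l) \<partial>lborel)"
      by (rule order_trans[OF integral_norm_bound])
        (intro integral_mono integrable_norm int_\<phi> integrable_mult_right F norm_\<phi>)
    finally show "norm \<bar>f n y\<bar> \<le> \<omega> * \<bar>a n\<bar> * (\<integral>l. cmod (F l) \<partial>lborel)" by simp
  qed
  have f_norm_summable: "summable (\<lambda>n. \<integral>y. \<bar>f n y\<bar> \<partial>lborel)"
    by (rule summable_comparison_test'[OF sum_a, of 0]) (use f_L1 in auto)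
  have g'_eq: "g' = (\<lambda>y. \<Sum>n. f n y)" using sums_unique[OF sums_g'] by auto
  have g'_int: "integrable lborel g'"
    unfolding g'_eq by (rule integrable_suminf[OF f_int]) (use f_abs_summable f_norm_summable in auto)
  have abs_int: "integrable lborel (\<lambda>y. \<Sum>n. \<bar>f n y\<bar>)"
    and abs_eq: "(\<integral>y. (\<Sum>n. \<bar>f n y\<bar>) \<partial>lborel) = (\<Sum>n. \<integral>y. \<bar>f n y\<bar> \<partial>lborel)"
    using integrable_suminf[of lborel "\<lambda>n y. \<bar>f n y\<bar>"] integral_suminf[of lborel "\<lambda>n y. \<bar>f n y\<bar>"]
      f_int f_abs_summable f_norm_summable by auto
  have "(\<integral>y. \<bar>g' y\<bar> \<partial>lborel) \<le> (\<integral>y. (\<Sum>n. \<bar>f n y\<bar>) \<partial>lborel)"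
    unfolding g'_eq
    by (intro integral_mono abs_int summable_rabs f_abs_summable) (use g'_int g'_eq in simp)
  also have "\<dots> \<le> (\<Sum>n. \<omega> * \<bar>a n\<bar> * (\<integral>y. \<bar>g y\<bar> \<partial>lborel))"
    unfolding abs_eq by (rule suminf_le[OF f_L1 f_norm_summable sum_a])
  also have "\<dots> = \<omega> * (\<Sum>n. \<bar>a n\<bar>) * (\<integral>y. \<bar>g y\<bar> \<partial>lborel)"
    using a(1) by (simp add: suminf_mult suminf_mult2[symmetric] summable_mult)
  also have "\<dots> \<le> \<omega> * 2 * (\<integral>y. \<bar>g y\<bar> \<partial>lborel)"
    using assms(1) a(2) by (intro mult_right_mono mult_left_mono) auto
  finally have "(\<integral>y. \<bar>g' y\<bar> \<partial>lborel) \<le> 2 * \<omega> * (\<integral>y. \<bar>g y\<bar> \<partial>lborel)" by (simp add: mult.commute)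
  moreover have "g t - g s = (LINT y:{s..t}|lborel. g' y)" if "s \<le> t" for s t
    unfolding g'_def rep using derivative_of_Fourier_integral[OF F supp that] by simp
  ultimately show ?thesis using g'_int by blast
qed

lemma band_limited_linear:
  assumes "g \<in> band_limited \<omega>" and "h \<in> band_limited \<omega>"
  shows "(\<lambda>t. a * g t + h t) \<in> band_limited \<omega>"
proof -
  obtain F where g: "integrable lborel g" and F: "integrable lborel F" "\<And>l. \<omega> < \<bar>l\<bar> \<Longrightarrow> F l = 0"
    and g_rep: "\<And>y. g y = Re (\<integral>l. F l * cis (y * l) \<partial>lborel)"
    using assms(1) unfolding band_limited_def by auto
  obtain H where h: "integrable lborel h" and H: "integrable lborel H" "\<And>l. \<omega> < \<bar>l\<bar> \<Longrightarrow> H l = 0"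
    and h_rep: "\<And>y. h y = Re (\<integral>l. H l * cis (y * l) \<partial>lborel)"
    using assms(2) unfolding band_limited_def by auto
  have int: "integrable lborel (\<lambda>l. K l * cis (y * l))" if "integrable lborel K" for K y
    by (rule integrable_mult_bounded[OF that, where B = 1]) (auto simp: norm_mult)
  have "(\<integral>l. (of_real a * F l + H l) * cis (y * l) \<partial>lborel)
      = of_real a * (\<integral>l. F l * cis (y * l) \<partial>lborel) + (\<integral>l. H l * cis (y * l) \<partial>lborel)" for y
    using int[OF F(1)] int[OF H(1)] by (simp add: distrib_right mult.assoc)
  then have "a * g y + h y = Re (\<integral>l. (of_real a * F l + H l) * cis (y * l) \<partial>lborel)" for y
    by (simp add: g_rep h_rep)
  then show ?thesis
    unfolding band_limited_def
  proof (intro CollectI conjI exI[of _ "\<lambda>l. of_real a * F l + H l"] allI)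
    show "integrable lborel (\<lambda>t. a * g t + h t)" using g h by simp
    show "integrable lborel (\<lambda>l. of_real a * F l + H l)" using F(1) H(1) by simp
  qed (use F(2) H(2) in simp_all)
qed

section \<open>Fourier inversion and Paley--Wiener functions\<close>

definition L1_fourier_transform :: "(real \<Rightarrow> complex) \<Rightarrow> real \<Rightarrow> complex" where
  "L1_fourier_transform f l = of_real (1 / sqrt (2 * pi)) * (\<integral>y. f y * cis (- (y * l)) \<partial>lborel)"

lemma integrable_gaussian: "integrable lborel (\<lambda>u::real. exp (- u\<^sup>2 / 2))"
proof -
  have "integrable lborel (\<lambda>u. sqrt (2 * pi) * std_normal_density u)"
    using integrable_std_normal_moment[of 0] by (intro integrable_mult_right) simp
  then show ?thesis by (simp add: std_normal_density_def)
qed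

text \<open>
  The characteristic function of the standard normal distribution, freed of its normalisation.
\<close>
lemma gaussian_fourier_integral:
  "(\<integral>u. cis (t * u) * of_real (exp (- u\<^sup>2 / 2)) \<partial>lborel) = of_real (sqrt (2 * pi) * exp (- t\<^sup>2 / 2))"
proof -
  have "of_real (exp (- t\<^sup>2 / 2)) = char std_normal_distribution t"
    by (simp add: char_std_normal_distribution)
  also have "\<dots> = (\<integral>u. std_normal_density u *\<^sub>R cis (t * u) \<partial>lborel)"
    unfolding char_def by (subst integral_density) (auto simp: cis_conv_exp normal_density_nonneg)
  also have "\<dots> = (\<integral>u. of_real (1 / sqrt (2 * pi)) * (cis (t * u) * of_real (exp (- u\<^sup>2 / 2))) \<partial>lborel)"
    by (intro Bochner_Integration.integral_cong) (auto simp: std_normal_density_def scaleR_conv_of_real)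
  also have "\<dots> = of_real (1 / sqrt (2 * pi)) * (\<integral>u. cis (t * u) * of_real (exp (- u\<^sup>2 / 2)) \<partial>lborel)"
    by simp
  finally show ?thesis by (simp add: field_simps)
qed

lemma scaled_gaussian_fourier_integral:
  assumes "0 < N"
  shows "integrable lborel (\<lambda>l::real. exp (- (l / N)\<^sup>2 / 2))"
    and "(\<integral>l. cis (t * l) * of_real (exp (- (l / N)\<^sup>2 / 2)) \<partial>lborel)
      = of_real (sqrt (2 * pi) * (N * exp (- (t * N)\<^sup>2 / 2)))"
proof -
  show "integrable lborel (\<lambda>l::real. exp (- (l / N)\<^sup>2 / 2))"
    using lborel_integrable_real_affine[OF integrable_gaussian, of "1 / N" 0] assms by simp
  have "(\<integral>l. cis (t * l) * of_real (exp (- (l / N)\<^sup>2 / 2)) \<partial>lborel)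
      = \<bar>N\<bar> *\<^sub>R (\<integral>u. cis (t * (0 + N * u)) * of_real (exp (- ((0 + N * u) / N)\<^sup>2 / 2)) \<partial>lborel)"
    by (rule lborel_integral_real_affine) (use assms in simp)
  also have "\<dots> = N *\<^sub>R (\<integral>u. cis (t * N * u) * of_real (exp (- u\<^sup>2 / 2)) \<partial>lborel)"
    using assms by (simp add: mult.assoc)
  also have "\<dots> = of_real (sqrt (2 * pi) * (N * exp (- (t * N)\<^sup>2 / 2)))"
    unfolding gaussian_fourier_integral by (simp add: scaleR_conv_of_real)
  finally show "(\<integral>l. cis (t * l) * of_real (exp (- (l / N)\<^sup>2 / 2)) \<partial>lborel)
      = of_real (sqrt (2 * pi) * (N * exp (- (t * N)\<^sup>2 / 2)))" .
qed

text \<open>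
  The function \<open>f\<close> need not be bounded, so the substitution \<open>y = x + u/n\<close> with dominated convergence
  handles only its part on \<open>[x - 1, x + 1]\<close>, where continuity supplies a bound. At distance at least
  \<open>1\<close> from \<open>x\<close> the kernel is at most \<open>2/n\<close>, and integrability of \<open>f\<close> is enough.
\<close>
lemma gaussian_approximate_identity:
  fixes f :: "real \<Rightarrow> complex"
  assumes f: "integrable lborel f" and cont: "continuous_on UNIV f"
  shows "(\<lambda>n. \<integral>y. f y * of_real (real (Suc n) * exp (- ((x - y) * real (Suc n))\<^sup>2 / 2)) \<partial>lborel)
    \<longlonglongrightarrow> of_real (sqrt (2 * pi)) * f x"
proof -
  note [measurable] = borel_measurable_integrable[OF f]
  define k where "k n y = real (Suc n) * exp (- ((x - y) * real (Suc n))\<^sup>2 / 2)" for n y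
  define near where "near y = indicator {x - 1..x + 1} y *\<^sub>R f y" for y
  define far where "far y = indicator (- {x - 1..x + 1}) y *\<^sub>R f y" for y
  have [measurable]: "near \<in> borel_measurable lborel" "far \<in> borel_measurable lborel"
    unfolding near_def far_def by measurable
  have k_nonneg: "0 \<le> k n y" for n y by (simp add: k_def)
  have [measurable]: "k n \<in> borel_measurable borel" for n unfolding k_def by measurable
  have k_le: "k n y \<le> real (Suc n)" for n y
    unfolding k_def by (rule mult_right_le_one_le) auto
  have int: "integrable lborel (\<lambda>y. f' y * of_real (k n y))"
    if f': "integrable lborel f'" for f' :: "real \<Rightarrow> complex" and n
  proof (rule integrable_mult_bounded[OF f'])
    show "cmod (f' y * of_real (k n y)) \<le> real (Suc n) * cmod (f' y)" for y
      using mult_left_mono[OF k_le, of "cmod (f' y)" n y] k_nonneg[of n y]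
      by (simp add: norm_mult mult.commute)
  qed measurable
  have near_int: "integrable lborel near" and far_int: "integrable lborel far"
    unfolding near_def far_def by (intro integrable_mult_indicator f; simp)+
  have far_lim: "(\<lambda>n. \<integral>y. far y * of_real (k n y) \<partial>lborel) \<longlonglongrightarrow> 0"
  proof (rule Lim_null_comparison[OF always_eventually])
    show "(\<lambda>n. 2 * (\<integral>y. cmod (far y) \<partial>lborel) / real (Suc n)) \<longlonglongrightarrow> 0"
      by (rule LIMSEQ_Suc[OF lim_const_over_n])
    \<comment> \<open>At distance at least \<open>1\<close>, \<open>exp (-z) \<le> 1/z\<close> turns the Gaussian decay into a factor \<open>2 / N\<^sup>2\<close>.\<close>
    have far_le: "cmod (far y * of_real (k n y)) \<le> 2 / real (Suc n) * cmod (far y)" for n y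
    proof (cases "y \<in> {x - 1..x + 1}")
      case False
      let ?N = "real (Suc n)" and ?z = "((x - y) * real (Suc n))\<^sup>2 / 2"
      have "1 \<le> \<bar>x - y\<bar>" using False by auto
      then have "1 \<le> (x - y)\<^sup>2" using abs_le_square_iff[of 1 "x - y"] by simp
      then have "1 * ?N\<^sup>2 \<le> (x - y)\<^sup>2 * ?N\<^sup>2" by (rule mult_right_mono) simp
      then have "?N\<^sup>2 / 2 \<le> ?z" by (simp add: power_mult_distrib)
      also have "?z \<le> exp ?z" using exp_ge_add_one_self[of ?z] by linarith
      finally have "?N\<^sup>2 / 2 \<le> exp ?z" .
      then have "exp (- ?z) \<le> 2 / ?N\<^sup>2"
        unfolding exp_minus by (subst inverse_eq_divide, subst divide_le_eq) (auto simp: field_simps)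
      then have "k n y \<le> ?N * (2 / ?N\<^sup>2)"
        unfolding k_def by (intro mult_left_mono) auto
      also have "\<dots> = 2 / ?N" by (simp add: power2_eq_square del: of_nat_Suc)
      finally have "cmod (far y) * k n y \<le> cmod (far y) * (2 / ?N)"
        by (rule mult_left_mono) simp
      then show ?thesis using k_nonneg[of n y] by (simp add: norm_mult mult.commute)
    qed (simp add: far_def)
    show "\<forall>n. norm (\<integral>y. far y * of_real (k n y) \<partial>lborel) \<le> 2 * (\<integral>y. cmod (far y) \<partial>lborel) / real (Suc n)"
    proof
      fix n
      have "norm (\<integral>y. far y * of_real (k n y) \<partial>lborel) \<le> (\<integral>y. 2 / real (Suc n) * cmod (far y) \<partial>lborel)"
        by (rule order_trans[OF integral_norm_bound])
          (intro integral_mono integrable_norm integrable_mult_right int far_int far_le)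
      then show "norm (\<integral>y. far y * of_real (k n y) \<partial>lborel) \<le> 2 * (\<integral>y. cmod (far y) \<partial>lborel) / real (Suc n)"
        by simp
    qed
  qed
  have near_lim: "(\<lambda>n. \<integral>y. near y * of_real (k n y) \<partial>lborel) \<longlonglongrightarrow> of_real (sqrt (2 * pi)) * f x"
  proof -
    have "bounded (f ` {x - 1..x + 1})"
      by (intro compact_imp_bounded compact_continuous_image continuous_on_subset[OF cont]) auto
    then obtain B where B: "\<And>y. y \<in> {x - 1..x + 1} \<Longrightarrow> cmod (f y) \<le> B"
      unfolding bounded_iff by blast
    have B_nonneg: "0 \<le> B" using order_trans[OF norm_ge_zero B[of x]] by simp
    have subst: "(\<integral>y. near y * of_real (k n y) \<partial>lborel)
        = (\<integral>u. near (x + 1 / real (Suc n) * u) * of_real (exp (- u\<^sup>2 / 2)) \<partial>lborel)" for n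
    proof -
      have "(\<integral>y. near y * of_real (k n y) \<partial>lborel)
          = \<bar>1 / real (Suc n)\<bar> *\<^sub>R (\<integral>u. near (x + 1 / real (Suc n) * u)
              * of_real (k n (x + 1 / real (Suc n) * u)) \<partial>lborel)"
        by (rule lborel_integral_real_affine) simp
      also have "\<dots> = (\<integral>u. \<bar>1 / real (Suc n)\<bar> *\<^sub>R (near (x + 1 / real (Suc n) * u)
              * of_real (k n (x + 1 / real (Suc n) * u))) \<partial>lborel)"
        by (rule integral_scaleR_right[symmetric])
      also have "\<dots> = (\<integral>u. near (x + 1 / real (Suc n) * u) * of_real (exp (- u\<^sup>2 / 2)) \<partial>lborel)"
        by (intro Bochner_Integration.integral_cong)
          (auto simp: k_def scaleR_conv_of_real power_divide simp del: of_nat_Suc)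
      finally show ?thesis .
    qed
    have "(\<lambda>n. \<integral>u. near (x + 1 / real (Suc n) * u) * of_real (exp (- u\<^sup>2 / 2)) \<partial>lborel)
        \<longlonglongrightarrow> (\<integral>u. f x * of_real (exp (- u\<^sup>2 / 2)) \<partial>lborel)"
    proof (rule integral_dominated_convergence[where w = "\<lambda>u. B * exp (- u\<^sup>2 / 2)"])
      show "integrable lborel (\<lambda>u. B * exp (- u\<^sup>2 / 2))"
        by (intro integrable_mult_right integrable_gaussian)
      have "isCont near x"
      proof -
        have "\<forall>\<^sub>F y in nhds x. near y = f y"
        proof (rule eventually_mono)
          show "\<forall>\<^sub>F y in nhds x. y \<in> {x - 1<..<x + 1}"
            by (rule eventually_nhds_in_open) auto
        qed (auto simp: near_def)
        then show ?thesis
          using isCont_cong[of near f x] cont by (simp add: continuous_on_eq_continuous_at)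
      qed
      moreover have "(\<lambda>n. x + 1 / real (Suc n) * u) \<longlonglongrightarrow> x" for u
        using tendsto_add[OF tendsto_const[of x] tendsto_mult[OF LIMSEQ_inverse_real_of_nat tendsto_const[of u]]]
        by (simp add: inverse_eq_divide)
      ultimately have "(\<lambda>n. near (x + 1 / real (Suc n) * u)) \<longlonglongrightarrow> near x" for u
        by (rule isCont_tendsto_compose)
      then show "AE u in lborel. (\<lambda>n. near (x + 1 / real (Suc n) * u) * of_real (exp (- u\<^sup>2 / 2)))
          \<longlonglongrightarrow> f x * of_real (exp (- u\<^sup>2 / 2))"
        by (intro AE_I2 tendsto_mult tendsto_const) (simp add: near_def)
      show "AE u in lborel. norm (near (x + 1 / real (Suc n) * u) * of_real (exp (- u\<^sup>2 / 2)))
          \<le> B * exp (- u\<^sup>2 / 2)" for n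
        by (intro AE_I2) (auto simp: norm_mult near_def B_nonneg intro!: mult_right_mono B split: split_indicator)
    qed measurable
    moreover have "(\<integral>u. f x * of_real (exp (- u\<^sup>2 / 2)) \<partial>lborel) = of_real (sqrt (2 * pi)) * f x"
      using gaussian_fourier_integral[of 0] by (simp add: mult.commute)
    ultimately show ?thesis by (simp only: subst)
  qed
  have split: "(\<integral>y. f y * of_real (k n y) \<partial>lborel)
      = (\<integral>y. near y * of_real (k n y) \<partial>lborel) + (\<integral>y. far y * of_real (k n y) \<partial>lborel)" for n
    unfolding Bochner_Integration.integral_add[OF int[OF near_int] int[OF far_int], symmetric]
    by (intro Bochner_Integration.integral_cong) (auto simp: near_def far_def indicator_def)
  show ?thesis
    using tendsto_add[OF near_lim far_lim] unfolding split[symmetric] by (simp add: k_def)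
qed

text \<open>
  A Gaussian factor makes the double integral absolutely convergent, so the order of integration may be
  exchanged. The inner integral is then a Gaussian kernel concentrating at \<open>x\<close>, while the factor
  itself tends to \<open>1\<close>.
\<close>
proposition fourier_inversion_L1:
  fixes f :: "real \<Rightarrow> complex"
  assumes f: "integrable lborel f" and cont: "continuous_on UNIV f"
    and ft: "integrable lborel (L1_fourier_transform f)"
  shows "f x = (\<integral>l. of_real (1 / sqrt (2 * pi)) * L1_fourier_transform f l * cis (x * l) \<partial>lborel)"
proof -
  note [measurable] = borel_measurable_integrable[OF f] borel_measurable_integrable[OF ft]
  \<comment> \<open>The summation factor, equal to \<open>1\<close> in the limit.\<close>
  define e where "e n l = exp (- (l / real (Suc n))\<^sup>2 / 2)" for n l
  have e_nonneg: "0 \<le> e n l" and e_le: "e n l \<le> 1" for n l by (auto simp: e_def)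
  have [measurable]: "e n \<in> borel_measurable borel" for n unfolding e_def by measurable
  have e_int: "integrable lborel (e n)" for n
    unfolding e_def by (rule scaled_gaussian_fourier_integral(1)) simp
  have lim1: "(\<lambda>n. \<integral>l. L1_fourier_transform f l * cis (x * l) * of_real (e n l) \<partial>lborel)
      \<longlonglongrightarrow> (\<integral>l. L1_fourier_transform f l * cis (x * l) \<partial>lborel)"
  proof (rule integral_dominated_convergence[where w = "\<lambda>l. cmod (L1_fourier_transform f l)"])
    show "integrable lborel (\<lambda>l. cmod (L1_fourier_transform f l))" using ft by (rule integrable_norm)
    have e_lim: "(\<lambda>n. e n l) \<longlonglongrightarrow> 1" for l
    proof -
      have "(\<lambda>n. l * inverse (real (Suc n))) \<longlonglongrightarrow> l * 0"
        by (rule tendsto_mult_left[OF LIMSEQ_inverse_real_of_nat])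
      then have "(\<lambda>n. exp (- (l * inverse (real (Suc n)))\<^sup>2 / 2)) \<longlonglongrightarrow> exp (- (l * 0)\<^sup>2 / 2)"
        by (intro tendsto_exp tendsto_divide tendsto_minus tendsto_power tendsto_const) simp_all
      moreover have "exp (- (l * 0)\<^sup>2 / 2) = (1 :: real)" by simp
      ultimately show ?thesis
        by (simp only: e_def divide_inverse[of l])
    qed
    have "(\<lambda>n. L1_fourier_transform f l * cis (x * l) * of_real (e n l))
        \<longlonglongrightarrow> L1_fourier_transform f l * cis (x * l) * of_real 1" for l
      by (intro tendsto_mult tendsto_const tendsto_of_real e_lim)
    then show "AE l in lborel. (\<lambda>n. L1_fourier_transform f l * cis (x * l) * of_real (e n l))
        \<longlonglongrightarrow> L1_fourier_transform f l * cis (x * l)" by simp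
    show "AE l in lborel. norm (L1_fourier_transform f l * cis (x * l) * of_real (e n l))
        \<le> cmod (L1_fourier_transform f l)" for n
      using e_nonneg e_le by (intro AE_I2) (auto simp: norm_mult intro: mult_right_le_one_le)
  qed measurable
  have swap: "(\<integral>l. L1_fourier_transform f l * cis (x * l) * of_real (e n l) \<partial>lborel)
      = (\<integral>y. f y * of_real (real (Suc n) * exp (- ((x - y) * real (Suc n))\<^sup>2 / 2)) \<partial>lborel)" for n
  proof -
    define c where "c = 1 / sqrt (2 * pi)"
    have c_pos: "0 < c" by (simp add: c_def)
    define k where "k y l = of_real c * f y * (cis ((x - y) * l) * of_real (e n l))" for y l
    have norm_k: "norm (k y l) = c * cmod (f y) * e n l" for y l
      using c_pos e_nonneg by (simp add: k_def norm_mult)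
    have meas: "(\<lambda>(y, l). k y l) \<in> borel_measurable (lborel \<Otimes>\<^sub>M lborel)"
      unfolding k_def by measurable
    have int_k: "integrable (lborel \<Otimes>\<^sub>M lborel) (\<lambda>(y, l). k y l)"
    proof (rule lborel_pair.Fubini_integrable[OF meas])
      show "integrable lborel (\<lambda>y. \<integral>l. norm (case (y, l) of (y, l) \<Rightarrow> k y l) \<partial>lborel)"
        using f by (simp add: norm_k)
      have "integrable lborel (k y)" for y
      proof (rule Bochner_Integration.integrable_bound)
        show "integrable lborel (\<lambda>l. c * cmod (f y) * e n l)" by (intro integrable_mult_right e_int)
        show "k y \<in> borel_measurable lborel" unfolding k_def by measurable
        show "AE l in lborel. norm (k y l) \<le> norm (c * cmod (f y) * e n l)"
          unfolding norm_k by auto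
      qed
      then show "AE y in lborel. integrable lborel (\<lambda>l. case (y, l) of (y, l) \<Rightarrow> k y l)" by simp
    qed
    have "L1_fourier_transform f l * cis (x * l) * of_real (e n l) = (\<integral>y. k y l \<partial>lborel)" for l
    proof -
      have "(\<integral>y. k y l \<partial>lborel)
          = (\<integral>y. (of_real c * cis (x * l) * of_real (e n l)) * (f y * cis (- (y * l))) \<partial>lborel)"
        unfolding k_def
        by (intro Bochner_Integration.integral_cong) (auto simp: left_diff_distrib cis_divide[symmetric] cis_inverse[symmetric] field_simps)
      then show ?thesis by (simp add: L1_fourier_transform_def c_def)
    qed
    then have "(\<integral>l. L1_fourier_transform f l * cis (x * l) * of_real (e n l) \<partial>lborel)
        = (\<integral>l. (\<integral>y. k y l \<partial>lborel) \<partial>lborel)" by simp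
    also have "\<dots> = (\<integral>y. (\<integral>l. k y l \<partial>lborel) \<partial>lborel)"
      by (rule lborel_pair.Fubini_integral[OF int_k])
    also have "\<dots> = (\<integral>y. f y * of_real (real (Suc n) * exp (- ((x - y) * real (Suc n))\<^sup>2 / 2)) \<partial>lborel)"
    proof (rule Bochner_Integration.integral_cong[OF refl])
      fix y
      have "(\<integral>l. k y l \<partial>lborel) = of_real c * f y * of_real (sqrt (2 * pi) * (real (Suc n) * exp (- ((x - y) * real (Suc n))\<^sup>2 / 2)))"
        unfolding k_def e_def integral_mult_right_zero
        by (subst scaled_gaussian_fourier_integral(2)) auto
      also have "\<dots> = of_real (c * sqrt (2 * pi)) * (f y * of_real (real (Suc n) * exp (- ((x - y) * real (Suc n))\<^sup>2 / 2)))"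
        by (simp only: of_real_mult mult_ac)
      also have "c * sqrt (2 * pi) = 1" by (simp add: c_def)
      finally show "(\<integral>l. k y l \<partial>lborel) = f y * of_real (real (Suc n) * exp (- ((x - y) * real (Suc n))\<^sup>2 / 2))"
        by (simp only: of_real_1 mult_1)
    qed
    finally show ?thesis .
  qed
  have "(\<integral>l. L1_fourier_transform f l * cis (x * l) \<partial>lborel) = of_real (sqrt (2 * pi)) * f x"
    using LIMSEQ_unique[OF lim1[unfolded swap] gaussian_approximate_identity[OF f cont]] .
  then show ?thesis
    unfolding mult.assoc integral_mult_right_zero by (simp flip: of_real_mult mult.assoc)
qed

text \<open>
  For integrable \<open>f\<close> the truncated transforms converge pointwise to the \<open>L\<^sub>1\<close>-transform, and
  by hypothesis in \<open>L\<^sub>2\<close> to a function vanishing outside \<open>[-\<omega>, \<omega>]\<close>. Fatou's lemma identifies the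
  two limits almost everywhere.
\<close>
lemma L1_fourier_transform_paley_wiener:
  assumes pw: "f \<in> paley_wiener \<omega>" and f: "integrable lborel f"
  shows "AE l in lborel. l \<notin> {- \<omega>..\<omega>} \<longrightarrow> L1_fourier_transform f l = 0"
proof -
  note [measurable] = borel_measurable_integrable[OF f]
  obtain g where g: "has_L2_fourier_transform f g" and supp: "AE l in lborel. l \<notin> {- \<omega>..\<omega>} \<longrightarrow> g l = 0"
    using pw by (auto simp: paley_wiener_def)
  have [measurable]: "g \<in> borel_measurable lborel"
    using g by (simp add: has_L2_fourier_transform_def square_integrable_def)
  have trunc_eq: "fourier_truncated f R l
      = of_real (1 / sqrt (2 * pi)) * (\<integral>y. indicator {- R..R} y *\<^sub>R (f y * cis (- (y * l))) \<partial>lborel)" for R l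
    unfolding fourier_truncated_def set_lebesgue_integral_def
    by (simp add: cis_conv_exp mult.commute)
  have trunc_meas [measurable]: "fourier_truncated f R \<in> borel_measurable lborel" for R
    unfolding trunc_eq by measurable
  have trunc_lim: "(\<lambda>n. fourier_truncated f (real n) l) \<longlonglongrightarrow> L1_fourier_transform f l" for l
    unfolding trunc_eq L1_fourier_transform_def
  proof (intro tendsto_mult tendsto_const integral_dominated_convergence[where w = "\<lambda>y. cmod (f y)"])
    show "AE y in lborel. (\<lambda>n. indicator {- real n..real n} y *\<^sub>R (f y * cis (- (y * l)))) \<longlonglongrightarrow> f y * cis (- (y * l))"
    proof (intro AE_I2 tendsto_eventually)
      fix y :: real
      obtain N where N: "\<bar>y\<bar> \<le> real N" using real_arch_simple by blast
      show "\<forall>\<^sub>F n in sequentially. indicator {- real n..real n} y *\<^sub>R (f y * cis (- (y * l))) = f y * cis (- (y * l))"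
        using eventually_ge_at_top[of N]
      proof eventually_elim
        case (elim n)
        then have "\<bar>y\<bar> \<le> real n" using N by linarith
        then show ?case by (auto simp: indicator_def)
      qed
    qed
  qed (use f in \<open>auto simp: norm_mult split: split_indicator\<close>)
  have "((\<lambda>n. \<integral>\<^sup>+ l. ennreal ((cmod (fourier_truncated f (real n) l - g l))\<^sup>2) \<partial>lborel) \<longlonglongrightarrow> 0)"
    using g filterlim_compose[OF _ filterlim_real_sequentially] unfolding has_L2_fourier_transform_def by blast
  then have liminf: "liminf (\<lambda>n. \<integral>\<^sup>+ l. ennreal ((cmod (fourier_truncated f (real n) l - g l))\<^sup>2) \<partial>lborel) = 0"
    by (intro lim_imp_Liminf) auto
  have "(\<integral>\<^sup>+ l. ennreal ((cmod (L1_fourier_transform f l - g l))\<^sup>2) \<partial>lborel)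
      = (\<integral>\<^sup>+ l. liminf (\<lambda>n. ennreal ((cmod (fourier_truncated f (real n) l - g l))\<^sup>2)) \<partial>lborel)"
    by (intro nn_integral_cong lim_imp_Liminf[symmetric] tendsto_ennrealI tendsto_intros trunc_lim) auto
  also have "\<dots> \<le> 0"
    unfolding liminf[symmetric] by (rule nn_integral_liminf) measurable
  finally have zero: "(\<integral>\<^sup>+ l. ennreal ((cmod (L1_fourier_transform f l - g l))\<^sup>2) \<partial>lborel) = 0" by simp
  have [measurable]: "L1_fourier_transform f \<in> borel_measurable lborel"
    unfolding L1_fourier_transform_def by measurable
  from zero have "AE l in lborel. L1_fourier_transform f l = g l"
    by (subst (asm) nn_integral_0_iff_AE) auto
  with supp show ?thesis by eventually_elim auto
qed

text \<open>
  The \<open>L\<^sub>1\<close>-transform is bounded and vanishes almost everywhere outside a bounded interval, hence is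
  integrable, which is what inversion requires. Its values on the exceptional null set
  are changed to zero to make the support condition hold everywhere.
\<close>
lemma paley_wiener_fourier_integral:
  assumes pw: "f \<in> paley_wiener \<omega>" and f: "integrable lborel f"
  obtains F where "integrable lborel F" and "\<And>l. \<omega> < \<bar>l\<bar> \<Longrightarrow> F l = 0"
    and "\<And>x. f x = (\<integral>l. F l * cis (x * l) \<partial>lborel)"
proof -
  note [measurable] = borel_measurable_integrable[OF f]
  let ?h = "L1_fourier_transform f" and ?c = "complex_of_real (1 / sqrt (2 * pi))"
  define B where "B = cmod ?c * (\<integral>y. cmod (f y) \<partial>lborel)"
  have bound: "cmod (?h l) \<le> B" for l
  proof -
    have "cmod (\<integral>y. f y * cis (- (y * l)) \<partial>lborel) \<le> (\<integral>y. cmod (f y * cis (- (y * l))) \<partial>lborel)"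
      by (rule integral_norm_bound)
    then show ?thesis
      unfolding L1_fourier_transform_def B_def norm_mult by (intro mult_left_mono) auto
  qed
  have supp: "AE l in lborel. l \<notin> {- \<omega>..\<omega>} \<longrightarrow> ?h l = 0"
    by (rule L1_fourier_transform_paley_wiener[OF pw f])
  have meas [measurable]: "?h \<in> borel_measurable lborel"
    unfolding L1_fourier_transform_def by measurable
  have h_int: "integrable lborel ?h"
  proof (rule Bochner_Integration.integrable_bound)
    show "integrable lborel (\<lambda>l. indicator {- \<omega>..\<omega>} l *\<^sub>R B)"
      by (simp add: emeasure_lborel_Icc_eq)
    show "AE l in lborel. norm (?h l) \<le> norm (indicator {- \<omega>..\<omega>} l *\<^sub>R B)"
      using supp by eventually_elim (auto simp: indicator_def intro: order_trans[OF bound abs_ge_self])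
  qed (fact meas)
  define F where "F l = indicator {- \<omega>..\<omega>} l *\<^sub>R (?c * ?h l)" for l
  show thesis
  proof (rule that)
    show "integrable lborel F"
      unfolding F_def using h_int by (intro integrable_mult_indicator integrable_mult_right) auto
    show "F l = 0" if "\<omega> < \<bar>l\<bar>" for l
      using that by (auto simp: F_def indicator_def)
    have "continuous_on UNIV f" using pw by (simp add: paley_wiener_def)
    from fourier_inversion_L1[OF f this h_int]
    have inv: "f x = (\<integral>l. ?c * ?h l * cis (x * l) \<partial>lborel)" for x .
    have "(\<integral>l. ?c * ?h l * cis (x * l) \<partial>lborel) = (\<integral>l. F l * cis (x * l) \<partial>lborel)" for x
    proof (rule integral_cong_AE)
      show "AE l in lborel. ?c * ?h l * cis (x * l) = F l * cis (x * l)"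
        using supp by eventually_elim (auto simp: F_def indicator_def)
    qed (unfold F_def, measurable)
    then show "f x = (\<integral>l. F l * cis (x * l) \<partial>lborel)" for x
      using inv[of x] by (rule trans[rotated])
  qed
qed

lemma paley_wiener_Re_Im_band_limited:
  assumes pw: "f \<in> paley_wiener \<omega>" and f: "integrable lborel f"
  shows "(\<lambda>x. Re (f x)) \<in> band_limited \<omega>" and "(\<lambda>x. Im (f x)) \<in> band_limited \<omega>"
proof -
  obtain F where F: "integrable lborel F" "\<And>l. \<omega> < \<bar>l\<bar> \<Longrightarrow> F l = 0"
    and rep: "\<And>x. f x = (\<integral>l. F l * cis (x * l) \<partial>lborel)"
    using paley_wiener_fourier_integral[OF pw f] by blast
  show "(\<lambda>x. Re (f x)) \<in> band_limited \<omega>"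
    unfolding band_limited_def
  proof (intro CollectI conjI exI[of _ F] allI)
    show "integrable lborel (\<lambda>x. Re (f x))" using f by (rule integrable_Re)
  qed (use F rep in simp_all)
  have Im_rep: "Im (f x) = Re (\<integral>l. (- \<i> * F l) * cis (x * l) \<partial>lborel)" for x
    unfolding mult.assoc integral_mult_right_zero rep[symmetric] by simp
  show "(\<lambda>x. Im (f x)) \<in> band_limited \<omega>"
    unfolding band_limited_def
  proof (intro CollectI conjI exI[of _ "\<lambda>l. - \<i> * F l"] allI)
    show "integrable lborel (\<lambda>x. Im (f x))" using f by (rule integrable_Im)
    show "integrable lborel (\<lambda>l. - \<i> * F l)" using F(1) by (rule integrable_mult_right)
    show "Im (f y) = Re (\<integral>l. - \<i> * F l * cis (y * l) \<partial>lborel)" for y by (rule Im_rep)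
  qed (use F(2) in simp)
qed

section \<open>Quadrature for Paley--Wiener functions\<close>

theorem theorem2p3:
  fixes \<omega> \<gamma> :: real
  assumes "\<omega> > 0" and "0 < \<gamma>" and "\<gamma> < 1"
  shows "\<exists>c1 > 0. \<exists>c2 > 0. \<forall>(\<rho>::real) (x :: int \<Rightarrow> real).
           0 < \<rho> \<and> \<rho> < 1 / 6 * inverse \<omega> * \<gamma> \<and> strict_mono x \<and>
           (\<forall>k. \<rho> / 2 \<le> \<bar>x k - x (k + 1)\<bar> \<and> \<bar>x k - x (k + 1)\<bar> \<le> \<rho>) \<longrightarrow>
           (\<exists>\<Lambda> :: int \<Rightarrow> real.
              (\<forall>k. 0 < \<Lambda> k \<and> c1 * \<rho> \<le> \<Lambda> k \<and> \<Lambda> k \<le> c2 * \<rho>) \<and>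
              (\<forall>f. f \<in> paley_wiener \<omega> \<and> integrable lborel f \<longrightarrow>
                 ((\<lambda>k. complex_of_real (\<Lambda> k) * f (x k)) has_sum (integral\<^sup>L lborel f)) UNIV))"
proof -
  have "\<exists>\<Lambda> :: int \<Rightarrow> real.
      (\<forall>k. 0 < \<Lambda> k \<and> 1 / 4 * \<rho> \<le> \<Lambda> k \<and> \<Lambda> k \<le> 3 / 2 * \<rho>) \<and>
      (\<forall>f. f \<in> paley_wiener \<omega> \<and> integrable lborel f \<longrightarrow>
         ((\<lambda>k. complex_of_real (\<Lambda> k) * f (x k)) has_sum (integral\<^sup>L lborel f)) UNIV)"
    if \<rho>: "0 < \<rho>" "\<rho> < 1 / 6 * inverse \<omega> * \<gamma>" and x: "strict_mono x"
      and gap: "\<forall>k. \<rho> / 2 \<le> \<bar>x k - x (k + 1)\<bar> \<and> \<bar>x k - x (k + 1)\<bar> \<le> \<rho>"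
    for \<rho> :: real and x :: "int \<Rightarrow> real"
  proof -
    have gap_eq: "\<bar>x k - x (k + 1)\<bar> = x (k + 1) - x k" for k
      using strict_monoD[OF x, of k "k + 1"] by simp
    have "\<rho> * (2 * \<omega>) \<le> (1 / 6 * inverse \<omega> * \<gamma>) * (2 * \<omega>)"
      using \<rho> assms(1) by (intro mult_right_mono) auto
    also have "\<dots> \<le> 1 / 3" using assms by simp
    finally have small: "\<rho> * (2 * \<omega>) \<le> 1 / 3" .
    have "\<exists>\<Lambda>. (\<forall>k. 1 / 4 * \<rho> \<le> \<Lambda> k \<and> \<Lambda> k \<le> 3 / 2 * \<rho>) \<and>
        (\<forall>g\<in>band_limited \<omega>. ((\<lambda>k. \<Lambda> k * g (x k)) has_sum (\<integral>t. g t \<partial>lborel)) UNIV)"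
    proof (rule positive_quadrature_from_Bernstein[OF _ _ _ x \<rho>(1) small])
      show "(\<lambda>t. a * g t + h t) \<in> band_limited \<omega>"
        if "g \<in> band_limited \<omega>" "h \<in> band_limited \<omega>" for g h a
        using that by (rule band_limited_linear)
      show "integrable lborel g" if "g \<in> band_limited \<omega>" for g
        using that by (simp add: band_limited_def)
      show "\<exists>g'. integrable lborel g' \<and> (\<forall>s t. s \<le> t \<longrightarrow> g t - g s = (LINT y:{s..t}|lborel. g' y)) \<and>
          (\<integral>t. \<bar>g' t\<bar> \<partial>lborel) \<le> 2 * \<omega> * (\<integral>t. \<bar>g t\<bar> \<partial>lborel)" if "g \<in> band_limited \<omega>" for g
        by (rule Bernstein_inequality_L1[OF assms(1) that])
      show "\<rho> / 2 \<le> x (k + 1) - x k" "x (k + 1) - x k \<le> \<rho>" for k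
        using gap by (auto simp: gap_eq)
    qed
    then obtain \<Lambda> where \<Lambda>: "\<And>k. 1 / 4 * \<rho> \<le> \<Lambda> k" "\<And>k. \<Lambda> k \<le> 3 / 2 * \<rho>"
      and quad: "\<And>g. g \<in> band_limited \<omega> \<Longrightarrow> ((\<lambda>k. \<Lambda> k * g (x k)) has_sum (\<integral>t. g t \<partial>lborel)) UNIV"
      by blast
    have "((\<lambda>k. complex_of_real (\<Lambda> k) * f (x k)) has_sum (integral\<^sup>L lborel f)) UNIV"
      if pw: "f \<in> paley_wiener \<omega>" and f: "integrable lborel f" for f
    proof -
      note parts = paley_wiener_Re_Im_band_limited[OF pw f]
      have "((\<lambda>k. complex_of_real (\<Lambda> k * Re (f (x k))) + \<i> * complex_of_real (\<Lambda> k * Im (f (x k))))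
          has_sum (of_real (\<integral>t. Re (f t) \<partial>lborel) + \<i> * of_real (\<integral>t. Im (f t) \<partial>lborel))) UNIV"
        by (intro has_sum_add has_sum_cmult_right has_sum_of_real quad parts)
      moreover have "complex_of_real (\<Lambda> k * Re (f (x k))) + \<i> * complex_of_real (\<Lambda> k * Im (f (x k)))
          = complex_of_real (\<Lambda> k) * f (x k)" for k
        by (simp add: complex_eq_iff)
      moreover have "of_real (\<integral>t. Re (f t) \<partial>lborel) + \<i> * of_real (\<integral>t. Im (f t) \<partial>lborel) = integral\<^sup>L lborel f"
        using f by (simp add: complex_eq_iff integral_Re integral_Im)
      ultimately show ?thesis by simp
    qed
    moreover have "0 < \<Lambda> k" for k using \<Lambda>(1)[of k] \<rho>(1) by linarith
    ultimately show ?thesis using \<Lambda> by blast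
  qed
  then show ?thesis
    by (intro exI[of _ "1 / 4 :: real"] exI[of _ "3 / 2 :: real"] conjI allI impI) auto
qed

end
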